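(* Let $\boldsymbol k$ be an algebraically closed field with $\operatorname{char}\boldsymbol k\neq 2$, let $V$ be a vector space over $\boldsymbol k$ of finite dimension $n$, let $\mathcal M:=V^*\otimes V^*\otimes V$, and let $G:=\mathrm{GL}(V)$ act naturally on $\mathcal M$. Then the field $\boldsymbol k(\mathcal M)^G$ of $G$-invariant rational functions on $\mathcal M$ is a rational extension of $\boldsymbol k$ of transcendence degree $n^3-n^2$.
   Context: A field extension $K/\boldsymbol k$ is called rational if either $K$ is a finitely generated purely transcendental extension of $\boldsymbol k$ or $K=\boldsymbol k$. Elements of $\mathcal M$ correspond to bilinear maps $V\times V\to V$ (equivalently, not necessarily associative $\boldsymbol k$-algebra structures on $V$); the action of $G$ is the natural one on the tensor product. *)

theory Defs
  imports "HOL-Computational_Algebra.Polynomial"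
begin

text \<open>Polynomial functions in the variables indexed by a set I (over an infinite
  field these are the same as polynomials in those variables).\<close>
inductive_set polyfun :: "'v set \<Rightarrow> (('v \<Rightarrow> 'k::comm_ring_1) \<Rightarrow> 'k) set"
  for I :: "'v set" where
  const: "(\<lambda>x. a) \<in> polyfun I"
| var: "v \<in> I \<Longrightarrow> (\<lambda>x. x v) \<in> polyfun I"
| add: "p \<in> polyfun I \<Longrightarrow> q \<in> polyfun I \<Longrightarrow> (\<lambda>x. p x + q x) \<in> polyfun I"
| mult: "p \<in> polyfun I \<Longrightarrow> q \<in> polyfun I \<Longrightarrow> (\<lambda>x. p x * q x) \<in> polyfun I"

definition alg_closed :: "'k::field itself \<Rightarrow> bool" where
  "alg_closed _ \<longleftrightarrow> (\<forall>p::'k poly. degree p > 0 \<longrightarrow> (\<exists>x. poly p x = 0))"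

text \<open>V = k^n with basis indexed by 'n.  An element of M = V* \<otimes> V* \<otimes> V is given by its
  structure constants c(i,j,l): the bilinear map B with B(e_i,e_j) = \<Sum>_l c(i,j,l) e_l.\<close>
type_synonym ('n, 'k) tensorM = "'n \<times> 'n \<times> 'n \<Rightarrow> 'k"

definition is_inverse :: "('n::finite \<Rightarrow> 'n \<Rightarrow> 'k::field) \<Rightarrow> ('n \<Rightarrow> 'n \<Rightarrow> 'k) \<Rightarrow> bool" where
  "is_inverse g h \<longleftrightarrow>
     (\<forall>i j. (\<Sum>m\<in>UNIV. g i m * h m j) = (if i = j then 1 else 0)) \<and>
     (\<forall>i j. (\<Sum>m\<in>UNIV. h i m * g m j) = (if i = j then 1 else 0))"

text \<open>Natural action: (g.B)(x,y) = g B(g^{-1} x, g^{-1} y), with h = g^{-1}.\<close>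
definition gl_act :: "('n::finite \<Rightarrow> 'n \<Rightarrow> 'k::field) \<Rightarrow> ('n \<Rightarrow> 'n \<Rightarrow> 'k) \<Rightarrow>
    ('n, 'k) tensorM \<Rightarrow> ('n, 'k) tensorM" where
  "gl_act g h c = (\<lambda>(i, j, l). \<Sum>a\<in>UNIV. \<Sum>b\<in>UNIV. \<Sum>d\<in>UNIV.
       g l d * c (a, b, d) * h a i * h b j)"

text \<open>The pair (P,Q) represents a G-invariant rational function P/Q on M, i.e. an
  element of k(M)^G: P, Q polynomial, Q nonzero, and (P/Q) \<circ> g = P/Q in k(M).\<close>
definition inv_ratfun :: "(('n::finite, 'k::field) tensorM \<Rightarrow> 'k) \<Rightarrow> (('n, 'k) tensorM \<Rightarrow> 'k) \<Rightarrow> bool" where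
  "inv_ratfun P Q \<longleftrightarrow> P \<in> polyfun UNIV \<and> Q \<in> polyfun UNIV \<and> Q \<noteq> (\<lambda>_. 0) \<and>
     (\<forall>g h c. is_inverse g h \<longrightarrow> P (gl_act g h c) * Q c = P c * Q (gl_act g h c))"

definition ratvals :: "nat \<Rightarrow> (nat \<Rightarrow> 'm \<Rightarrow> 'k::field) \<Rightarrow> (nat \<Rightarrow> 'm \<Rightarrow> 'k) \<Rightarrow> 'm \<Rightarrow> nat \<Rightarrow> 'k" where
  "ratvals N P Q c = (\<lambda>t. if t < N then P t c / Q t c else 0)"

text \<open>k(M)^G is a rational (purely transcendental, or trivial when N = 0) extension of k
  with transcendence degree N: there are N elements f_t = P t / Q t of k(M)^G which are
  algebraically independent over k and generate k(M)^G as a field over k.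
  Identities of rational functions are tested on the dense open set where all
  denominators are nonzero.\<close>
definition invariant_field_rational_trdeg :: "'n::finite itself \<Rightarrow> 'k::field itself \<Rightarrow> nat \<Rightarrow> bool" where
  "invariant_field_rational_trdeg _ _ N \<longleftrightarrow>
    (\<exists>(P :: nat \<Rightarrow> ('n, 'k) tensorM \<Rightarrow> 'k) (Q :: nat \<Rightarrow> ('n, 'k) tensorM \<Rightarrow> 'k).
       (\<forall>t<N. inv_ratfun (P t) (Q t)) \<and>
       \<comment> \<open>algebraic independence over k\<close>
       (\<forall>F \<in> polyfun {..<N}.
          (\<forall>c. (\<forall>t<N. Q t c \<noteq> 0) \<longrightarrow> F (ratvals N P Q c) = 0) \<longrightarrow> F = (\<lambda>_. 0)) \<and>
       \<comment> \<open>k(M)^G = k(f_0, ..., f_{N-1})\<close>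
       (\<forall>P' Q'. inv_ratfun P' Q' \<longrightarrow>
          (\<exists>A \<in> polyfun {..<N}. \<exists>B \<in> polyfun {..<N}.
             (\<exists>c. (\<forall>t<N. Q t c \<noteq> 0) \<and> B (ratvals N P Q c) \<noteq> 0) \<and>
             (\<forall>c. (\<forall>t<N. Q t c \<noteq> 0) \<and> Q' c \<noteq> 0 \<and> B (ratvals N P Q c) \<noteq> 0 \<longrightarrow>
                P' c / Q' c = A (ratvals N P Q c) / B (ratvals N P Q c)))))"

end

theory Submission
  imports Defs "HOL-Analysis.Determinants"
begin

text \<open>The idea is to attach to a generic algebra c a basis of the dual space, the rows of a matrix
  F c, such that F (g.c) = F c ** g^{-1}. Then every generic orbit meets the slice F = 1 in exactly
  one point, and the invariant field is the function field of the slice.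

  Let \<lambda> and \<rho> be the traces of the left and right multiplications, and let T be the
  endomorphism with \<lambda>(x (T y)) = \<rho>(x y). For n \<ge> 3 the frame is \<lambda>, \<rho>, \<rho> T, \<rho> T^2, \<dots>
  Where it is the standard basis e_1*, ..., e_n*, the forms \<lambda>(xy) and \<rho>(xy) are the first two
  layers c(-,-,1) and c(-,-,2), so that c(-,-,2) = c(-,-,1) T, where all rows of T except the first
  and the last are prescribed. The slice is therefore parametrised by those two rows and by the
  layers c(-,-,l) with l \<noteq> 2, subject only to the trace conditions \<lambda> = e_1* and \<rho> = e_2*. These
  can be solved polynomially for 2n entries, so the slice is rational.\<close>

section \<open>Polynomial functions over an infinite field\<close>

text \<open>Euclid's argument: over a finite field, adding 1 to the product of all
  \<open>X - a\<close> gives a polynomial of positive degree without a root.\<close>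

lemma infinite_UNIV_if_alg_closed:
  assumes "alg_closed TYPE('k::field)"
  shows "infinite (UNIV :: 'k set)"
proof
  assume fin: "finite (UNIV :: 'k set)"
  define p :: "'k poly" where "p = (\<Prod>a\<in>UNIV. [:-a, 1:])"
  have "degree p = card (UNIV :: 'k set)"
    unfolding p_def by (subst degree_prod_eq_sum_degree) auto
  then have deg: "degree p > 0"
    using fin by (simp add: card_gt_0_iff)
  have "degree (p + 1) > 0"
    using deg by (subst degree_add_eq_left) auto
  then obtain x where "poly (p + 1) x = 0"
    using assms unfolding alg_closed_def by blast
  moreover have "poly p x = 0"
    unfolding p_def poly_prod using fin by (intro prod_zero) auto
  ultimately show False by simp
qed

lemma polyfun_uminus: "p \<in> polyfun I \<Longrightarrow> (\<lambda>x. - p x) \<in> polyfun I"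
  using polyfun.mult[OF polyfun.const[of "-1"]] by fastforce

lemma polyfun_diff: "p \<in> polyfun I \<Longrightarrow> q \<in> polyfun I \<Longrightarrow> (\<lambda>x. p x - q x) \<in> polyfun I"
  using polyfun.add[OF _ polyfun_uminus] by fastforce

lemma polyfun_sum: "(\<And>a. a \<in> S \<Longrightarrow> p a \<in> polyfun I) \<Longrightarrow> (\<lambda>x. \<Sum>a\<in>S. p a x) \<in> polyfun I"
  by (induction S rule: infinite_finite_induct) (auto intro: polyfun.intros)

lemma polyfun_if:
  "(b \<Longrightarrow> p \<in> polyfun I) \<Longrightarrow> (\<not> b \<Longrightarrow> q \<in> polyfun I) \<Longrightarrow> (\<lambda>x. if b then p x else q x) \<in> polyfun I"
  by (cases b) simp_all

lemma polyfun_compose: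
  assumes "p \<in> polyfun I" "\<And>v. v \<in> I \<Longrightarrow> (\<lambda>u. \<Phi> u v) \<in> polyfun J"
  shows "(\<lambda>u. p (\<Phi> u)) \<in> polyfun J"
  using assms by induction (auto intro: polyfun.intros)

lemma polyfun_cong_on:
  assumes "p \<in> polyfun I" "\<And>v. v \<in> I \<Longrightarrow> x v = y v"
  shows "p x = p y"
  using assms by induction auto

text \<open>Restriction to the line that runs from \<open>x\<close> at \<open>s = 0\<close> to
  \<open>y\<close> at \<open>s = 1\<close> turns questions about zeros into questions about
  polynomials in one variable.\<close>

lemma polyfun_on_line:
  assumes "p \<in> polyfun I"
  shows "\<exists>P. \<forall>s. p (\<lambda>v. x v + s * (y v - x v)) = poly P s"
  using assms
proof induction
  case (const a)
  show ?case by (intro exI[of _ "[:a:]"]) simp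
next
  case (var v)
  show ?case by (intro exI[of _ "[:x v, y v - x v:]"]) simp
next
  case (add p q)
  then obtain P Q where "\<forall>s. p (\<lambda>v. x v + s * (y v - x v)) = poly P s"
    "\<forall>s. q (\<lambda>v. x v + s * (y v - x v)) = poly Q s" by blast
  then show ?case by (intro exI[of _ "P + Q"]) simp
next
  case (mult p q)
  then obtain P Q where "\<forall>s. p (\<lambda>v. x v + s * (y v - x v)) = poly P s"
    "\<forall>s. q (\<lambda>v. x v + s * (y v - x v)) = poly Q s" by blast
  then show ?case by (intro exI[of _ "P * Q"]) simp
qed

text \<open>This plays the role of irreducibility of affine space. On the line joining
  \<open>x\<close> and \<open>y\<close> both functions restrict to nonzero polynomials, whose
  product has only finitely many roots.\<close>

lemma polyfun_common_nonzero:
  fixes p q :: "('v \<Rightarrow> 'k::field) \<Rightarrow> 'k"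
  assumes inf: "infinite (UNIV :: 'k set)"
    and p: "p \<in> polyfun I" "p x \<noteq> 0" and q: "q \<in> polyfun I" "q y \<noteq> 0"
  obtains z where "p z \<noteq> 0" "q z \<noteq> 0"
proof -
  obtain P Q where P: "\<And>s. p (\<lambda>v. x v + s * (y v - x v)) = poly P s"
    and Q: "\<And>s. q (\<lambda>v. x v + s * (y v - x v)) = poly Q s"
    using polyfun_on_line[OF p(1)] polyfun_on_line[OF q(1)] by blast
  have "P \<noteq> 0" "Q \<noteq> 0"
    using P[of 0] Q[of 1] p(2) q(2) by auto
  then have "finite {s. poly (P * Q) s = 0}"
    by (intro poly_roots_finite) simp
  then obtain s where "poly (P * Q) s \<noteq> 0"
    using inf by (metis (mono_tags, lifting) UNIV_eq_I mem_Collect_eq)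
  then show thesis
    using that[of "\<lambda>v. x v + s * (y v - x v)"] P Q by simp
qed

section \<open>Quotients of polynomial functions\<close>

text \<open>A single fraction must serve on all of \<open>U\<close>. Values off \<open>U\<close> are
  unconstrained, which accommodates total functions such as \<open>matrix_inv\<close>.\<close>

definition regular_on :: "('v \<Rightarrow> 'k::field) set \<Rightarrow> (('v \<Rightarrow> 'k) \<Rightarrow> 'k) set" where
  "regular_on U = {f. \<exists>p\<in>polyfun UNIV. \<exists>q\<in>polyfun UNIV. \<forall>c\<in>U. q c \<noteq> 0 \<and> f c = p c / q c}"

lemma regular_onE:
  assumes "f \<in> regular_on U"
  obtains p q where "p \<in> polyfun UNIV" "q \<in> polyfun UNIV"
    "\<And>c. c \<in> U \<Longrightarrow> q c \<noteq> 0" "\<And>c. c \<in> U \<Longrightarrow> f c = p c / q c"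
  using assms unfolding regular_on_def by blast

lemma regular_onI:
  assumes "p \<in> polyfun UNIV" "q \<in> polyfun UNIV"
    "\<And>c. c \<in> U \<Longrightarrow> q c \<noteq> 0" "\<And>c. c \<in> U \<Longrightarrow> f c = p c / q c"
  shows "f \<in> regular_on U"
  using assms unfolding regular_on_def by blast

lemma regular_on_cong:
  assumes "f \<in> regular_on U" "\<And>c. c \<in> U \<Longrightarrow> f c = g c"
  shows "g \<in> regular_on U"
  using assms(1) by (rule regular_onE) (auto simp: assms(2)[symmetric] intro: regular_onI)

lemma regular_on_polyfun: "p \<in> polyfun UNIV \<Longrightarrow> p \<in> regular_on U"
  by (rule regular_onI[of p "\<lambda>_. 1"]) (auto intro: polyfun.const)

lemma regular_on_const: "(\<lambda>_. a) \<in> regular_on U"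
  by (intro regular_on_polyfun polyfun.const)

lemma regular_on_var: "(\<lambda>c. c v) \<in> regular_on U"
  by (intro regular_on_polyfun polyfun.var UNIV_I)

lemma regular_on_add:
  assumes "f \<in> regular_on U" "g \<in> regular_on U"
  shows "(\<lambda>c. f c + g c) \<in> regular_on U"
  using assms(1)
proof (rule regular_onE)
  fix p q assume 1: "p \<in> polyfun UNIV" "q \<in> polyfun UNIV"
    "\<And>c. c \<in> U \<Longrightarrow> q c \<noteq> 0" "\<And>c. c \<in> U \<Longrightarrow> f c = p c / q c"
  from assms(2) show ?thesis
  proof (rule regular_onE)
    fix p' q' assume 2: "p' \<in> polyfun UNIV" "q' \<in> polyfun UNIV"
      "\<And>c. c \<in> U \<Longrightarrow> q' c \<noteq> 0" "\<And>c. c \<in> U \<Longrightarrow> g c = p' c / q' c"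
    show ?thesis
      by (rule regular_onI[of "\<lambda>c. p c * q' c + p' c * q c" "\<lambda>c. q c * q' c"])
        (use 1 2 in \<open>auto intro: polyfun.intros simp: add_frac_eq\<close>)
  qed
qed

lemma regular_on_mult:
  assumes "f \<in> regular_on U" "g \<in> regular_on U"
  shows "(\<lambda>c. f c * g c) \<in> regular_on U"
  using assms(1)
proof (rule regular_onE)
  fix p q assume 1: "p \<in> polyfun UNIV" "q \<in> polyfun UNIV"
    "\<And>c. c \<in> U \<Longrightarrow> q c \<noteq> 0" "\<And>c. c \<in> U \<Longrightarrow> f c = p c / q c"
  from assms(2) show ?thesis
  proof (rule regular_onE)
    fix p' q' assume 2: "p' \<in> polyfun UNIV" "q' \<in> polyfun UNIV"
      "\<And>c. c \<in> U \<Longrightarrow> q' c \<noteq> 0" "\<And>c. c \<in> U \<Longrightarrow> g c = p' c / q' c"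
    show ?thesis
      by (rule regular_onI[of "\<lambda>c. p c * p' c" "\<lambda>c. q c * q' c"])
        (use 1 2 in \<open>auto intro: polyfun.intros\<close>)
  qed
qed

lemma regular_on_inverse:
  assumes "f \<in> regular_on U" "\<And>c. c \<in> U \<Longrightarrow> f c \<noteq> 0"
  shows "(\<lambda>c. inverse (f c)) \<in> regular_on U"
  using assms(1)
proof (rule regular_onE)
  fix p q assume 1: "p \<in> polyfun UNIV" "q \<in> polyfun UNIV"
    "\<And>c. c \<in> U \<Longrightarrow> q c \<noteq> 0" "\<And>c. c \<in> U \<Longrightarrow> f c = p c / q c"
  show ?thesis
  proof (rule regular_onI[of q p])
    fix c assume "c \<in> U"
    then show "p c \<noteq> 0" "inverse (f c) = q c / p c"
      using 1(3,4) assms(2)[of c] by auto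
  qed (use 1 in auto)
qed

lemma regular_on_divide:
  assumes "f \<in> regular_on U" "g \<in> regular_on U" "\<And>c. c \<in> U \<Longrightarrow> g c \<noteq> 0"
  shows "(\<lambda>c. f c / g c) \<in> regular_on U"
  unfolding divide_inverse using assms by (intro regular_on_mult regular_on_inverse)

lemma regular_on_if:
  "(b \<Longrightarrow> f \<in> regular_on U) \<Longrightarrow> (\<not> b \<Longrightarrow> g \<in> regular_on U) \<Longrightarrow> (\<lambda>c. if b then f c else g c) \<in> regular_on U"
  by (cases b) simp_all

lemma regular_on_sum:
  "(\<And>a. a \<in> S \<Longrightarrow> f a \<in> regular_on U) \<Longrightarrow> (\<lambda>c. \<Sum>a\<in>S. f a c) \<in> regular_on U"
  by (induction S rule: infinite_finite_induct) (auto intro: regular_on_add regular_on_const)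

lemma regular_on_prod:
  "(\<And>a. a \<in> S \<Longrightarrow> f a \<in> regular_on U) \<Longrightarrow> (\<lambda>c. \<Prod>a\<in>S. f a c) \<in> regular_on U"
  by (induction S rule: infinite_finite_induct) (auto intro: regular_on_mult regular_on_const)

lemma regular_on_compose:
  assumes f: "f \<in> regular_on U" and \<Phi>: "\<And>v. (\<lambda>c. \<Phi> c v) \<in> regular_on W"
    and img: "\<And>c. c \<in> W \<Longrightarrow> \<Phi> c \<in> U"
  shows "(\<lambda>c. f (\<Phi> c)) \<in> regular_on W"
proof -
  have poly: "(\<lambda>c. p (\<Phi> c)) \<in> regular_on W" if "p \<in> polyfun UNIV" for p
    using that by induction (auto intro: regular_on_const \<Phi> regular_on_add regular_on_mult)
  from f show ?thesis
  proof (rule regular_onE)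
    fix p q assume 1: "p \<in> polyfun UNIV" "q \<in> polyfun UNIV"
      "\<And>c. c \<in> U \<Longrightarrow> q c \<noteq> 0" "\<And>c. c \<in> U \<Longrightarrow> f c = p c / q c"
    have "(\<lambda>c. p (\<Phi> c) / q (\<Phi> c)) \<in> regular_on W"
      using 1 img poly by (intro regular_on_divide) auto
    then show ?thesis
      by (rule regular_on_cong) (simp add: 1(4) img)
  qed
qed

text \<open>If \<open>g = p / q\<close> where \<open>D\<close> does not vanish, then
  \<open>D * p\<close> cuts out the smaller set. Conditions on rational expressions can thus be
  added while the domain stays the nonvanishing set of one polynomial.\<close>

lemma regular_on_nonvanishing:
  assumes D: "D \<in> polyfun UNIV" and g: "g \<in> regular_on {c. D c \<noteq> 0}"
  obtains D' where "D' \<in> polyfun UNIV" "{c. D' c \<noteq> 0} = {c. D c \<noteq> 0 \<and> g c \<noteq> 0}"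
  using g
proof (rule regular_onE)
  fix p q assume "p \<in> polyfun UNIV" "q \<in> polyfun UNIV"
    and pq: "\<And>c. c \<in> {c. D c \<noteq> 0} \<Longrightarrow> q c \<noteq> 0" "\<And>c. c \<in> {c. D c \<noteq> 0} \<Longrightarrow> g c = p c / q c"
  then have "(\<lambda>c. D c * p c) \<in> polyfun UNIV" using D by (intro polyfun.mult)
  moreover have "{c. D c * p c \<noteq> 0} = {c. D c \<noteq> 0 \<and> g c \<noteq> 0}"
    using pq by auto
  ultimately show thesis by (rule that)
qed

lemma regular_on_UNIV_nonvanishing:
  assumes "g \<in> regular_on UNIV"
  obtains D where "D \<in> polyfun UNIV" "{c. D c \<noteq> 0} = {c. g c \<noteq> 0}"
  using regular_on_nonvanishing[of "\<lambda>_. 1" g] assms by (auto intro: polyfun.const)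

section \<open>Determinants and inverses of matrices with regular entries\<close>

lemma regular_on_det:
  fixes M :: "('v \<Rightarrow> 'k::field) \<Rightarrow> 'k ^ 'n ^ 'n::finite"
  assumes "\<And>i j. (\<lambda>c. M c $ i $ j) \<in> regular_on U"
  shows "(\<lambda>c. det (M c)) \<in> regular_on U"
  unfolding det_def
  by (intro regular_on_sum regular_on_mult regular_on_const regular_on_prod assms)

lemma matrix_inv_mult:
  fixes M :: "'k::field ^ 'n ^ 'n::finite"
  assumes "det M \<noteq> 0"
  shows "M ** matrix_inv M = mat 1" "matrix_inv M ** M = mat 1"
proof -
  have "\<exists>N. M ** N = mat 1 \<and> N ** M = mat 1"
    using assms by (simp add: invertible_det_nz[symmetric] invertible_def)
  then have "M ** matrix_inv M = mat 1 \<and> matrix_inv M ** M = mat 1"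
    unfolding matrix_inv_def by (rule someI_ex)
  then show "M ** matrix_inv M = mat 1" "matrix_inv M ** M = mat 1" by simp_all
qed

text \<open>Cramer's rule: column \<open>j\<close> of the inverse solves
  \<open>M x = axis j 1\<close>, and \<open>R c\<close> is \<open>M c\<close> with column
  \<open>i\<close> replaced by that right-hand side.\<close>

lemma regular_on_matrix_inv:
  fixes M :: "('v \<Rightarrow> 'k::field) \<Rightarrow> 'k ^ 'n ^ 'n::finite"
  assumes M: "\<And>i j. (\<lambda>c. M c $ i $ j) \<in> regular_on U"
    and det: "\<And>c. c \<in> U \<Longrightarrow> det (M c) \<noteq> 0"
  shows "(\<lambda>c. matrix_inv (M c) $ i $ j) \<in> regular_on U"
proof -
  define R where "R c = (\<chi> a b. if b = i then axis j 1 $ a else M c $ a $ b)" for c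
  have "(\<lambda>c. R c $ a $ b) \<in> regular_on U" for a b
    unfolding R_def by (cases "b = i") (auto intro: M regular_on_const)
  then have "(\<lambda>c. det (R c) / det (M c)) \<in> regular_on U"
    using M det by (intro regular_on_divide regular_on_det)
  then show ?thesis
  proof (rule regular_on_cong)
    fix c assume c: "c \<in> U"
    have "M c *v (matrix_inv (M c) *v axis j 1) = axis j 1"
      by (simp add: matrix_vector_mul_assoc matrix_inv_mult[OF det[OF c]])
    then have "matrix_inv (M c) *v axis j 1
        = (\<chi> k. det (\<chi> a b. if b = k then axis j 1 $ a else M c $ a $ b) / det (M c))"
      by (simp add: cramer[OF det[OF c]])
    then have "(matrix_inv (M c) *v axis j 1) $ i = det (R c) / det (M c)"
      by (simp add: R_def)
    then show "det (R c) / det (M c) = matrix_inv (M c) $ i $ j"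
      by (simp add: matrix_vector_mult_def axis_def if_distrib cong: if_cong)
  qed
qed

section \<open>The action in matrix form\<close>

lemma is_inverse_matrix:
  "is_inverse (\<lambda>i j. G $ i $ j) (\<lambda>i j. H $ i $ j) \<longleftrightarrow> G ** H = mat 1 \<and> H ** G = mat 1"
  for G H :: "'k::field ^ 'n ^ 'n::finite"
  by (simp add: is_inverse_def vec_eq_iff matrix_matrix_mult_def mat_def)

abbreviation mat_act :: "'k::field ^ 'n ^ 'n \<Rightarrow> 'k ^ 'n ^ 'n \<Rightarrow> ('n::finite, 'k) tensorM \<Rightarrow> ('n, 'k) tensorM" where
  "mat_act G H \<equiv> gl_act (\<lambda>i j. G $ i $ j) (\<lambda>i j. H $ i $ j)"

lemma is_inverse_imp_matrix:
  assumes "is_inverse g h"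
  obtains G H where "g = (\<lambda>i j. G $ i $ j)" "h = (\<lambda>i j. H $ i $ j)" "G ** H = mat 1" "H ** G = mat 1"
proof (rule that)
  show g: "g = (\<lambda>i j. (\<chi> a b. g a b) $ i $ j)" and h: "h = (\<lambda>i j. (\<chi> a b. h a b) $ i $ j)"
    by simp_all
  have "is_inverse (\<lambda>i j. (\<chi> a b. g a b) $ i $ j) (\<lambda>i j. (\<chi> a b. h a b) $ i $ j)"
    using assms by simp
  then show "(\<chi> a b. g a b) ** (\<chi> a b. h a b) = mat 1" "(\<chi> a b. h a b) ** (\<chi> a b. g a b) = mat 1"
    unfolding is_inverse_matrix by simp_all
qed

text \<open>The nested form keeps each coefficient in front of its own sum, so that neighbouring
  sums can be exchanged and contracted one at a time.\<close>

lemma mat_act_factor: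
  "mat_act G H c (i, j, l) =
    (\<Sum>a\<in>UNIV. H $ a $ i * (\<Sum>b\<in>UNIV. H $ b $ j * (\<Sum>d\<in>UNIV. G $ l $ d * c (a, b, d))))"
  by (simp add: gl_act_def sum_distrib_left mult_ac)

lemma sum_matrix_mult:
  fixes G G' :: "'k::field ^ 'n ^ 'n::finite"
  shows "(\<Sum>d\<in>UNIV. (G ** G') $ l $ d * x d) = (\<Sum>e\<in>UNIV. G $ l $ e * (\<Sum>d\<in>UNIV. G' $ e $ d * x d))"
    and "(\<Sum>d\<in>UNIV. (G ** G') $ d $ l * x d) = (\<Sum>e\<in>UNIV. G' $ e $ l * (\<Sum>d\<in>UNIV. G $ d $ e * x d))"
proof -
  show "(\<Sum>d\<in>UNIV. (G ** G') $ l $ d * x d) = (\<Sum>e\<in>UNIV. G $ l $ e * (\<Sum>d\<in>UNIV. G' $ e $ d * x d))"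
    unfolding matrix_matrix_mult_def
    by (simp add: sum_distrib_left sum_distrib_right mult_ac) (rule sum.swap)
  show "(\<Sum>d\<in>UNIV. (G ** G') $ d $ l * x d) = (\<Sum>e\<in>UNIV. G' $ e $ l * (\<Sum>d\<in>UNIV. G $ d $ e * x d))"
    unfolding matrix_matrix_mult_def
    by (simp add: sum_distrib_left sum_distrib_right mult_ac) (rule sum.swap)
qed

lemma sum_mult_swap:
  fixes f :: "'a \<Rightarrow> 'k::field"
  shows "(\<Sum>a\<in>A. f a * (\<Sum>b\<in>B. g b * x a b)) = (\<Sum>b\<in>B. g b * (\<Sum>a\<in>A. f a * x a b))"
  by (simp add: sum_distrib_left mult_ac) (rule sum.swap)

lemma mat_act_mat_act: "mat_act G H (mat_act G' H' c) = mat_act (G ** G') (H' ** H) c"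
proof (rule ext, clarify)
  fix i j l
  let ?s = "\<lambda>f. \<Sum>a\<in>UNIV. f a"
  have "mat_act G H (mat_act G' H' c) (i, j, l) =
    ?s (\<lambda>a. H $ a $ i * ?s (\<lambda>b. H $ b $ j * ?s (\<lambda>d. G $ l $ d *
    ?s (\<lambda>a'. H' $ a' $ a * ?s (\<lambda>b'. H' $ b' $ b * ?s (\<lambda>d'. G' $ d $ d' * c (a', b', d')))))))"
    by (simp add: mat_act_factor)
  \<comment> \<open>Three exchanges bring the order of summation to
    \<open>a, a', b, b', d, d'\<close>, where each pair contracts to a matrix product.\<close>
  also have "\<dots> = ?s (\<lambda>a. H $ a $ i * ?s (\<lambda>b. H $ b $ j *
    ?s (\<lambda>a'. H' $ a' $ a * ?s (\<lambda>d. G $ l $ d * ?s (\<lambda>b'. H' $ b' $ b * ?s (\<lambda>d'. G' $ d $ d' * c (a', b', d')))))))"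
    by (subst sum_mult_swap) (rule refl)
  also have "\<dots> = ?s (\<lambda>a. H $ a $ i * ?s (\<lambda>a'. H' $ a' $ a * ?s (\<lambda>b. H $ b $ j *
     ?s (\<lambda>d. G $ l $ d * ?s (\<lambda>b'. H' $ b' $ b * ?s (\<lambda>d'. G' $ d $ d' * c (a', b', d')))))))"
    by (subst (2) sum_mult_swap) (rule refl)
  also have "\<dots> = ?s (\<lambda>a. H $ a $ i * ?s (\<lambda>a'. H' $ a' $ a * ?s (\<lambda>b. H $ b $ j *
     ?s (\<lambda>b'. H' $ b' $ b * ?s (\<lambda>d. G $ l $ d * ?s (\<lambda>d'. G' $ d $ d' * c (a', b', d')))))))"
    by (subst (4) sum_mult_swap) (rule refl)
  also have "\<dots> = mat_act (G ** G') (H' ** H) c (i, j, l)"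
    by (simp add: mat_act_factor sum_matrix_mult)
  finally show "mat_act G H (mat_act G' H' c) (i, j, l) = mat_act (G ** G') (H' ** H) c (i, j, l)" .
qed

lemma sum_one_entry:
  "(\<Sum>d\<in>UNIV. (mat 1 :: 'k::field ^ 'n ^ 'n::finite) $ l $ d * x d) = x l"
  "(\<Sum>d\<in>UNIV. (mat 1 :: 'k::field ^ 'n ^ 'n::finite) $ d $ l * x d) = x l"
proof -
  have "(mat 1 :: 'k ^ 'n ^ 'n) $ a $ b * y = (if a = b then y else 0)" for a b y
    by (simp add: mat_def)
  then show "(\<Sum>d\<in>UNIV. (mat 1 :: 'k ^ 'n ^ 'n) $ l $ d * x d) = x l"
    "(\<Sum>d\<in>UNIV. (mat 1 :: 'k ^ 'n ^ 'n) $ d $ l * x d) = x l"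
    by simp_all
qed

lemma mat_act_one: "mat_act (mat 1) (mat 1) c = c"
  for c :: "('n::finite, 'k::field) tensorM"
  by (rule ext) (auto simp: mat_act_factor sum_one_entry)

lemma polyfun_mat_act: "(\<lambda>c. mat_act G H c m) \<in> polyfun UNIV"
  by (cases m) (simp only: mat_act_factor, intro polyfun_sum polyfun.mult polyfun.const polyfun.var UNIV_I)

lemma regular_on_mat_act:
  assumes "\<And>i j. (\<lambda>c. G c $ i $ j) \<in> regular_on U" "\<And>i j. (\<lambda>c. H c $ i $ j) \<in> regular_on U"
  shows "(\<lambda>c. mat_act (G c) (H c) c m) \<in> regular_on U"
  by (cases m) (simp only: mat_act_factor, intro regular_on_sum regular_on_mult regular_on_var assms)

section \<open>Equivariant frames and slices\<close>

text \<open>This is the method of moving frames. Each orbit in \<open>U\<close> meets the slice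
  \<open>F = mat 1\<close> in one point, which is a regular function of \<open>c\<close>. On the
  slice \<open>\<Psi>\<close> is a polynomial parametrisation with inverse \<open>f\<close>, so the
  coordinates \<open>f\<close> of that point are independent generators of the invariant
  field.\<close>

lemma invariant_field_rational_of_frame:
  fixes D :: "('n::finite, 'k::field) tensorM \<Rightarrow> 'k"
    and F :: "('n, 'k) tensorM \<Rightarrow> 'k ^ 'n ^ 'n"
    and f :: "'v \<Rightarrow> ('n, 'k) tensorM \<Rightarrow> 'k"
    and \<Psi> :: "('v \<Rightarrow> 'k) \<Rightarrow> ('n, 'k) tensorM"
  assumes inf: "infinite (UNIV :: 'k set)"
    and D: "D \<in> polyfun UNIV" and U: "U = {c. D c \<noteq> 0}" and ne: "U \<noteq> {}"
    and stable: "\<And>G H c. G ** H = mat 1 \<Longrightarrow> H ** G = mat 1 \<Longrightarrow> c \<in> U \<Longrightarrow> mat_act G H c \<in> U"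
    and equiv: "\<And>G H c. G ** H = mat 1 \<Longrightarrow> H ** G = mat 1 \<Longrightarrow> c \<in> U \<Longrightarrow>
      F (mat_act G H c) = F c ** H"
    and det: "\<And>c. c \<in> U \<Longrightarrow> det (F c) \<noteq> 0"
    and reg: "\<And>i j. (\<lambda>c. F c $ i $ j) \<in> regular_on U"
    and fin: "finite K"
    and f: "\<And>v. v \<in> K \<Longrightarrow> f v \<in> regular_on U"
    and \<Psi>: "\<And>m. (\<lambda>u. \<Psi> u m) \<in> polyfun K"
    and chart: "\<And>c. c \<in> U \<Longrightarrow> F c = mat 1 \<Longrightarrow> \<Psi> (\<lambda>v. f v c) = c"
    and slice: "\<And>u. \<Psi> u \<in> U \<Longrightarrow> F (\<Psi> u) = mat 1"
    and coord: "\<And>u v. \<Psi> u \<in> U \<Longrightarrow> v \<in> K \<Longrightarrow> f v (\<Psi> u) = u v"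
  shows "invariant_field_rational_trdeg TYPE('n) TYPE('k) (card K)"
proof -
  define N where "N = card K"
  obtain b where b: "bij_betw b {..<N} K"
    using fin ex_bij_betw_nat_finite[of K] unfolding N_def atLeast0LessThan by blast
  define b' where "b' = the_inv_into {..<N} b"
  have bK: "b t \<in> K" "b' (b t) = t" if "t < N" for t
    using b that unfolding b'_def bij_betw_def by (auto simp: the_inv_into_f_f)
  have b'K: "b' v < N" "b (b' v) = v" if "v \<in> K" for v
    using b that unfolding b'_def bij_betw_def
    by (auto simp: f_the_inv_into_f dest: the_inv_into_into[where B = "{..<N}"])
  \<comment> \<open>The group element \<open>F c\<close> moves \<open>c\<close> to a point with
    frame \<open>F c ** matrix_inv (F c) = mat 1\<close>, so \<open>NF c\<close> is the point of the
    orbit on the slice.\<close>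
  define NF where "NF c = mat_act (F c) (matrix_inv (F c)) c" for c
  have inv: "F c ** matrix_inv (F c) = mat 1" "matrix_inv (F c) ** F c = mat 1" if "c \<in> U" for c
    using matrix_inv_mult det that by blast+
  have NF_U: "NF c \<in> U" if "c \<in> U" for c
    unfolding NF_def using stable inv that by blast
  have F_NF: "F (NF c) = mat 1" if "c \<in> U" for c
    unfolding NF_def using equiv[OF inv] inv that by simp
  have NF_inv: "NF (mat_act G H c) = NF c" if GH: "G ** H = mat 1" "H ** G = mat 1" and c: "c \<in> U" for G H c
  proof -
    let ?c = "mat_act G H c"
    have c': "?c \<in> U" using stable GH c by blast
    have F': "F ?c = F c ** H" using equiv GH c by blast
    \<comment> \<open>The inserted factor is the identity; regrouping it exposes
      \<open>F c ** H = F ?c\<close>, which the inverse in front cancels.\<close>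
    have "matrix_inv (F ?c) = matrix_inv (F ?c) ** ((F c ** (H ** G)) ** matrix_inv (F c))"
      by (simp add: GH inv c)
    also have "\<dots> = (matrix_inv (F ?c) ** F ?c) ** (G ** matrix_inv (F c))"
      by (simp add: F' matrix_mul_assoc)
    finally have I: "matrix_inv (F ?c) = G ** matrix_inv (F c)"
      by (simp add: inv c')
    have "NF ?c = mat_act (F c ** H ** G) (H ** (G ** matrix_inv (F c))) c"
      unfolding NF_def I unfolding F' mat_act_mat_act ..
    also have "F c ** H ** G = F c"
      by (simp add: GH flip: matrix_mul_assoc)
    also have "H ** (G ** matrix_inv (F c)) = matrix_inv (F c)"
      by (simp add: matrix_mul_assoc GH)
    finally show ?thesis unfolding NF_def .
  qed
  have NF_reg: "(\<lambda>c. NF c m) \<in> regular_on U" for m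
    unfolding NF_def by (intro regular_on_mat_act reg regular_on_matrix_inv det)
  have f_NF: "(\<lambda>c. f v (NF c)) \<in> regular_on U" if "v \<in> K" for v
    by (rule regular_on_compose[OF f[OF that] NF_reg NF_U])
  have "\<forall>v\<in>K. \<exists>p q. p \<in> polyfun UNIV \<and> q \<in> polyfun UNIV \<and>
      (\<forall>c\<in>U. q c \<noteq> 0 \<and> f v (NF c) = p c / q c)"
    using f_NF unfolding regular_on_def by blast
  then obtain p q where pq: "\<And>v. v \<in> K \<Longrightarrow> p v \<in> polyfun UNIV" "\<And>v. v \<in> K \<Longrightarrow> q v \<in> polyfun UNIV"
    "\<And>v c. v \<in> K \<Longrightarrow> c \<in> U \<Longrightarrow> q v c \<noteq> 0" "\<And>v c. v \<in> K \<Longrightarrow> c \<in> U \<Longrightarrow> f v (NF c) = p v c / q v c"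
    by metis
  \<comment> \<open>The common factor \<open>D\<close> makes \<open>Q t\<close> vanish exactly off
    \<open>U\<close>. A nonzero denominator then means \<open>c \<in> U\<close>, and off
    \<open>U\<close> the invariance identity reads \<open>0 = 0\<close>.\<close>
  define P where "P t c = D c * p (b t) c" for t c
  define Q where "Q t c = D c * q (b t) c" for t c
  have Q_U: "Q t c \<noteq> 0 \<longleftrightarrow> c \<in> U" if "t < N" for t c
    unfolding Q_def using U pq(3)[OF bK(1)[OF that], of c] by auto
  have PQ: "P t c / Q t c = f (b t) (NF c)" if "t < N" "c \<in> U" for t c
    using pq(4)[OF bK(1)[OF that(1)] that(2)] that(2) U unfolding P_def Q_def by auto
  have inv_PQ: "inv_ratfun (P t) (Q t)" if t: "t < N" for t
    unfolding inv_ratfun_def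
  proof (intro conjI allI impI)
    show "P t \<in> polyfun UNIV" "Q t \<in> polyfun UNIV"
      unfolding P_def Q_def using D pq(1,2) bK(1)[OF t] by (auto intro: polyfun.mult)
    show "Q t \<noteq> (\<lambda>_. 0)"
      using ne Q_U[OF t] by (metis ex_in_conv)
    fix g h :: "'n \<Rightarrow> 'n \<Rightarrow> 'k" and c assume "is_inverse g h"
    then obtain G H where gh: "g = (\<lambda>i j. G $ i $ j)" "h = (\<lambda>i j. H $ i $ j)"
      and GH: "G ** H = mat 1" "H ** G = mat 1"
      by (rule is_inverse_imp_matrix)
    let ?c = "mat_act G H c"
    show "P t (gl_act g h c) * Q t c = P t c * Q t (gl_act g h c)"
      unfolding gh
    proof (cases "c \<in> U")
      case True
      then have "?c \<in> U" using stable GH by blast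
      moreover have "P t ?c / Q t ?c = P t c / Q t c"
        using PQ[OF t] NF_inv[OF GH] True \<open>?c \<in> U\<close> by simp
      ultimately show "P t ?c * Q t c = P t c * Q t ?c"
        using Q_U[OF t] True by (simp add: frac_eq_eq)
    next
      case False
      have "mat_act H G ?c = c"
        by (simp add: mat_act_mat_act GH mat_act_one)
      then have "?c \<notin> U" using stable[OF GH(2,1), of ?c] False by auto
      then have "D c = 0" "D ?c = 0" using False U by auto
      then show "P t ?c * Q t c = P t c * Q t ?c" by (simp add: P_def Q_def)
    qed
  qed
  define rv where "rv = ratvals N P Q"
  \<comment> \<open>\<open>\<Theta>\<close> is \<open>\<Psi>\<close> with its coordinates renumbered
    from \<open>K\<close> to \<open>0, ..., N - 1\<close>.\<close>
  define \<Theta> where "\<Theta> u = \<Psi> (\<lambda>v. u (b' v))" for u :: "nat \<Rightarrow> 'k"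
  have \<Theta>_poly: "(\<lambda>u. \<Theta> u m) \<in> polyfun {..<N}" for m
    unfolding \<Theta>_def by (rule polyfun_compose[OF \<Psi>]) (auto intro: polyfun.var b'K)
  have \<Theta>_cong: "\<Theta> u = \<Psi> w" if "\<And>v. v \<in> K \<Longrightarrow> u (b' v) = w v" for u w
    unfolding \<Theta>_def by (rule ext, rule polyfun_cong_on[OF \<Psi>]) (auto intro: that)
  have \<Theta>_rv: "\<Theta> (rv c) = NF c" if c: "c \<in> U" for c
  proof -
    have "\<Theta> (rv c) = \<Psi> (\<lambda>v. f v (NF c))"
      by (rule \<Theta>_cong) (simp add: rv_def ratvals_def b'K PQ c)
    then show ?thesis using chart[OF NF_U F_NF] c by simp
  qed
  have indep: "F' = (\<lambda>_. 0)" if F': "F' \<in> polyfun {..<N}"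
    and zero: "\<forall>c. (\<forall>t<N. Q t c \<noteq> 0) \<longrightarrow> F' (rv c) = 0" for F'
  proof (rule ccontr)
    assume "F' \<noteq> (\<lambda>_. 0)"
    then obtain u0 where u0: "F' u0 \<noteq> 0" by auto
    obtain c0 where c0: "c0 \<in> U" using ne by auto
    \<comment> \<open>So \<open>D\<close> composed with \<open>\<Theta>\<close> is not identically
      zero, and some \<open>u\<close> with \<open>F' u \<noteq> 0\<close> has
      \<open>\<Theta> u\<close> in \<open>U\<close>. The generators take the values \<open>u\<close>
      there, which contradicts the assumed relation.\<close>
    have "D (\<Theta> (rv c0)) \<noteq> 0"
      using NF_U[OF c0] U by (simp add: \<Theta>_rv[OF c0])
    moreover have "(\<lambda>u. D (\<Theta> u)) \<in> polyfun {..<N}"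
      by (rule polyfun_compose[OF D \<Theta>_poly])
    ultimately obtain u where u: "F' u \<noteq> 0" "D (\<Theta> u) \<noteq> 0"
      using polyfun_common_nonzero[OF inf F' u0, of "\<lambda>u. D (\<Theta> u)"] by metis
    then have c: "\<Theta> u \<in> U" using U by simp
    have "rv (\<Theta> u) t = u t" if t: "t < N" for t
    proof -
      have "rv (\<Theta> u) t = f (b t) (NF (\<Theta> u))"
        by (simp add: rv_def ratvals_def t PQ c)
      \<comment> \<open>A slice point has identity frame, so normalisation acts on it by the
        identity matrix.\<close>
      also have "NF (\<Theta> u) = \<Theta> u"
        using \<Theta>_def matrix_inv_mult(1)[of "mat 1 :: 'k^'n^'n"]
        by (simp add: NF_def slice c[unfolded \<Theta>_def] mat_act_one)
      also have "f (b t) (\<Theta> u) = u t"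
        unfolding \<Theta>_def using coord[OF c[unfolded \<Theta>_def] bK(1)[OF t]] bK(2)[OF t] by simp
      finally show ?thesis .
    qed
    then have "F' (rv (\<Theta> u)) = F' u"
      by (intro polyfun_cong_on[OF F']) simp
    then show False using zero u(1) c Q_U by simp
  qed
  have gen: "\<exists>A\<in>polyfun {..<N}. \<exists>B\<in>polyfun {..<N}.
     (\<exists>c. (\<forall>t<N. Q t c \<noteq> 0) \<and> B (rv c) \<noteq> 0) \<and>
     (\<forall>c. (\<forall>t<N. Q t c \<noteq> 0) \<and> Q' c \<noteq> 0 \<and> B (rv c) \<noteq> 0 \<longrightarrow> P' c / Q' c = A (rv c) / B (rv c))"
    if "inv_ratfun P' Q'" for P' Q'
  proof -
    have P': "P' \<in> polyfun UNIV" and Q': "Q' \<in> polyfun UNIV" and Q'0: "Q' \<noteq> (\<lambda>_. 0)"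
      and PQ': "\<And>g h c. is_inverse g h \<Longrightarrow> P' (gl_act g h c) * Q' c = P' c * Q' (gl_act g h c)"
      using that unfolding inv_ratfun_def by auto
    obtain y where "Q' y \<noteq> 0" using Q'0 by auto
    moreover obtain x where "D x \<noteq> 0" using ne U by auto
    ultimately obtain c0 where c0: "Q' c0 \<noteq> 0" "D c0 \<noteq> 0"
      using polyfun_common_nonzero[OF inf Q' _ D] by metis
    then have c0U: "c0 \<in> U" using U by simp
    \<comment> \<open>Q' may vanish on the whole slice, so evaluate on its translate through c0 instead.\<close>
    define G where "G = matrix_inv (F c0)"
    define H where "H = F c0"
    have GH: "G ** H = mat 1" "H ** G = mat 1"
      unfolding G_def H_def using inv c0U by auto
    define A where "A u = P' (mat_act G H (\<Theta> u))" for u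
    define B where "B u = Q' (mat_act G H (\<Theta> u))" for u
    have GH_poly: "(\<lambda>u. mat_act G H (\<Theta> u) m) \<in> polyfun {..<N}" for m
      by (rule polyfun_compose[OF polyfun_mat_act \<Theta>_poly])
    have A: "A \<in> polyfun {..<N}" and B: "B \<in> polyfun {..<N}"
      unfolding A_def B_def by (intro polyfun_compose[OF P' GH_poly] polyfun_compose[OF Q' GH_poly])+
    \<comment> \<open>The translated slice passes through \<open>c0\<close>, whence
      \<open>B (rv c0) = Q' c0\<close>.\<close>
    have "mat_act G H (NF c0) = c0"
      unfolding NF_def G_def H_def by (simp add: mat_act_mat_act inv c0U mat_act_one)
    then have B0: "B (rv c0) \<noteq> 0"
      unfolding B_def using \<Theta>_rv[OF c0U] c0 by simp
    \<comment> \<open>The translate of the normal form of \<open>c\<close> lies in the orbit of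
      \<open>c\<close>, so invariance of \<open>P' / Q'\<close> compares the values at the two
      points.\<close>
    have AB: "P' c * B (rv c) = A (rv c) * Q' c" if c: "c \<in> U" for c
    proof -
      have "mat_act G H (NF c) = mat_act (G ** F c) (matrix_inv (F c) ** H) c"
        unfolding NF_def mat_act_mat_act ..
      moreover have "is_inverse (\<lambda>i j. (G ** F c) $ i $ j) (\<lambda>i j. (matrix_inv (F c) ** H) $ i $ j)"
        unfolding is_inverse_matrix
      proof
        have "G ** F c ** (matrix_inv (F c) ** H) = G ** (F c ** matrix_inv (F c)) ** H"
          by (simp add: matrix_mul_assoc)
        then show "G ** F c ** (matrix_inv (F c) ** H) = mat 1" by (simp add: inv c GH)
        have "matrix_inv (F c) ** H ** (G ** F c) = matrix_inv (F c) ** (H ** G) ** F c"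
          by (simp add: matrix_mul_assoc)
        then show "matrix_inv (F c) ** H ** (G ** F c) = mat 1" by (simp add: inv c GH)
      qed
      ultimately show ?thesis
        using PQ'[of "\<lambda>i j. (G ** F c) $ i $ j" "\<lambda>i j. (matrix_inv (F c) ** H) $ i $ j" c]
        unfolding A_def B_def \<Theta>_rv[OF c] by simp
    qed
    have AB': "P' c * B (rv c) = A (rv c) * Q' c" if "\<forall>t<N. Q t c \<noteq> 0" for c
    \<comment> \<open>For \<open>N = 0\<close> the condition on denominators is empty and does not
      place \<open>c\<close> in \<open>U\<close>. Then \<open>rv\<close> is constant, so the
      identity is polynomial in \<open>c\<close> and extends from \<open>U\<close> by
      density.\<close>
    proof (cases "N = 0")
      case True
      then have rv: "rv c = rv c0" for c by (auto simp: rv_def ratvals_def)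
      define R where "R c = P' c * B (rv c0) - A (rv c0) * Q' c" for c
      have R: "R \<in> polyfun UNIV"
        unfolding R_def using P' Q' by (intro polyfun_diff polyfun.mult polyfun.const)
      have "R c = 0" if "D c \<noteq> 0" for c
        using AB[of c] that rv[of c] U by (simp add: R_def)
      then have "R c = 0"
        using polyfun_common_nonzero[OF inf R _ D c0(2), of c] by blast
      then show ?thesis unfolding rv[of c] R_def by simp
    next
      case False
      then show ?thesis using that Q_U[of 0] AB by auto
    qed
    have "\<exists>c. (\<forall>t<N. Q t c \<noteq> 0) \<and> B (rv c) \<noteq> 0"
      using B0 c0U Q_U by blast
    moreover have "P' c / Q' c = A (rv c) / B (rv c)"
      if "(\<forall>t<N. Q t c \<noteq> 0) \<and> Q' c \<noteq> 0 \<and> B (rv c) \<noteq> 0" for c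
      using that AB'[of c] by (simp add: frac_eq_eq)
    ultimately show ?thesis using A B by blast
  qed
  show ?thesis
    unfolding invariant_field_rational_trdeg_def N_def[symmetric]
    by (rule exI[of _ P], rule exI[of _ Q], intro conjI ballI allI impI)
       (use inv_PQ indep gen in \<open>auto simp: rv_def\<close>)
qed

section \<open>Covariants of an algebra\<close>

text \<open>Entry \<open>i\<close> is the trace of left multiplication by the basis vector with
  index \<open>i\<close>.\<close>

definition left_trace :: "('n::finite, 'k::field) tensorM \<Rightarrow> 'k ^ 'n" where
  "left_trace c = (\<chi> i. \<Sum>j\<in>UNIV. c (i, j, j))"

definition right_trace :: "('n::finite, 'k::field) tensorM \<Rightarrow> 'k ^ 'n" where
  "right_trace c = (\<chi> j. \<Sum>i\<in>UNIV. c (i, j, i))"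

text \<open>This is the Gram matrix of the bilinear form \<open>\<phi>(x y)\<close>.\<close>

definition contract :: "'k::field ^ 'n \<Rightarrow> ('n::finite, 'k) tensorM \<Rightarrow> 'k ^ 'n ^ 'n" where
  "contract \<phi> c = (\<chi> i j. \<Sum>l\<in>UNIV. \<phi> $ l * c (i, j, l))"

text \<open>An argument slot contracted with the output slot brings together \<open>H\<close> and
  \<open>G\<close>, which cancel. This is what makes both traces natural covectors.\<close>

lemma sum_matrix_cancel:
  fixes G H :: "'k::field ^ 'n ^ 'n::finite"
  assumes HG: "H ** G = mat 1"
  shows "(\<Sum>j\<in>UNIV. \<Sum>b\<in>UNIV. H $ b $ j * (\<Sum>d\<in>UNIV. G $ j $ d * y b d)) = (\<Sum>b\<in>UNIV. y b b)"
proof -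
  have "(\<Sum>j\<in>UNIV. \<Sum>b\<in>UNIV. H $ b $ j * (\<Sum>d\<in>UNIV. G $ j $ d * y b d))
    = (\<Sum>b\<in>UNIV. \<Sum>j\<in>UNIV. H $ b $ j * (\<Sum>d\<in>UNIV. G $ j $ d * y b d))"
    by (rule sum.swap)
  also have "\<dots> = (\<Sum>b\<in>UNIV. \<Sum>d\<in>UNIV. (H ** G) $ b $ d * y b d)"
    by (simp only: sum_matrix_mult)
  finally show ?thesis by (simp only: HG sum_one_entry)
qed

lemma left_trace_mat_act:
  fixes G H :: "'k::field ^ 'n ^ 'n::finite"
  assumes HG: "H ** G = mat 1"
  shows "left_trace (mat_act G H c) = left_trace c v* H"
proof -
  have "left_trace (mat_act G H c) $ i = (left_trace c v* H) $ i" for i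
  proof -
    have "left_trace (mat_act G H c) $ i =
      (\<Sum>j\<in>UNIV. \<Sum>a\<in>UNIV. H $ a $ i * (\<Sum>b\<in>UNIV. H $ b $ j * (\<Sum>d\<in>UNIV. G $ j $ d * c (a, b, d))))"
      by (simp add: left_trace_def mat_act_factor)
    also have "\<dots> = (\<Sum>a\<in>UNIV. H $ a $ i *
      (\<Sum>j\<in>UNIV. \<Sum>b\<in>UNIV. H $ b $ j * (\<Sum>d\<in>UNIV. G $ j $ d * c (a, b, d))))"
      by (subst sum.swap) (simp only: sum_distrib_left)
    also have "\<dots> = (left_trace c v* H) $ i"
      by (simp only: sum_matrix_cancel[OF HG]) (simp add: left_trace_def vector_matrix_mult_def mult.commute)
    finally show ?thesis .
  qed
  then show ?thesis by (simp add: vec_eq_iff)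
qed

lemma right_trace_mat_act:
  fixes G H :: "'k::field ^ 'n ^ 'n::finite"
  assumes HG: "H ** G = mat 1"
  shows "right_trace (mat_act G H c) = right_trace c v* H"
proof -
  have "right_trace (mat_act G H c) $ j = (right_trace c v* H) $ j" for j
  proof -
    have "right_trace (mat_act G H c) $ j =
      (\<Sum>i\<in>UNIV. \<Sum>a\<in>UNIV. H $ a $ i * (\<Sum>b\<in>UNIV. H $ b $ j * (\<Sum>d\<in>UNIV. G $ i $ d * c (a, b, d))))"
      by (simp add: right_trace_def mat_act_factor)
    also have "\<dots> = (\<Sum>i\<in>UNIV. \<Sum>b\<in>UNIV. H $ b $ j *
        (\<Sum>a\<in>UNIV. H $ a $ i * (\<Sum>d\<in>UNIV. G $ i $ d * c (a, b, d))))"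
      by (subst sum_mult_swap) (rule refl)
    also have "\<dots> = (\<Sum>b\<in>UNIV. H $ b $ j *
      (\<Sum>i\<in>UNIV. \<Sum>a\<in>UNIV. H $ a $ i * (\<Sum>d\<in>UNIV. G $ i $ d * c (a, b, d))))"
      by (subst sum.swap) (simp only: sum_distrib_left)
    also have "\<dots> = (right_trace c v* H) $ j"
      by (simp only: sum_matrix_cancel[OF HG]) (simp add: right_trace_def vector_matrix_mult_def mult.commute)
    finally show ?thesis .
  qed
  then show ?thesis by (simp add: vec_eq_iff)
qed

text \<open>Each argument slot contributes a factor \<open>H\<close>, giving a congruence; the
  \<open>G\<close> from the output slot cancels against the \<open>H\<close> in the transformed
  covector.\<close>

lemma contract_mat_act:
  fixes G H :: "'k::field ^ 'n ^ 'n::finite"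
  assumes HG: "H ** G = mat 1"
  shows "contract (\<phi> v* H) (mat_act G H c) = transpose H ** contract \<phi> c ** H"
proof -
  have "contract (\<phi> v* H) (mat_act G H c) $ i $ j = (transpose H ** contract \<phi> c ** H) $ i $ j" for i j
  proof -
    let ?s = "\<lambda>f. \<Sum>a\<in>UNIV. f a"
    have "contract (\<phi> v* H) (mat_act G H c) $ i $ j = ?s (\<lambda>l. (\<phi> v* H) $ l *
      ?s (\<lambda>a. H $ a $ i * ?s (\<lambda>b. H $ b $ j * ?s (\<lambda>d. G $ l $ d * c (a, b, d)))))"
      by (simp add: contract_def mat_act_factor)
    also have "\<dots> = ?s (\<lambda>a. H $ a $ i * ?s (\<lambda>l. (\<phi> v* H) $ l *
      ?s (\<lambda>b. H $ b $ j * ?s (\<lambda>d. G $ l $ d * c (a, b, d)))))"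
      by (rule sum_mult_swap)
    also have "\<dots> = ?s (\<lambda>a. H $ a $ i * ?s (\<lambda>b. H $ b $ j *
      ?s (\<lambda>l. (\<phi> v* H) $ l * ?s (\<lambda>d. G $ l $ d * c (a, b, d)))))"
      by (rule sum.cong, rule refl, subst sum_mult_swap, rule refl)
    also have "\<dots> = ?s (\<lambda>a. H $ a $ i * ?s (\<lambda>b. H $ b $ j * ?s (\<lambda>d. \<phi> $ d * c (a, b, d))))"
    proof -
      have "?s (\<lambda>l. (\<phi> v* H) $ l * ?s (\<lambda>d. G $ l $ d * x d)) = ?s (\<lambda>d. \<phi> $ d * x d)" for x
      proof -
        have "(\<phi> v* H) $ l * y = ?s (\<lambda>e. \<phi> $ e * (H $ e $ l * y))" for l y
          by (simp add: vector_matrix_mult_def sum_distrib_right mult.assoc)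
        then have "?s (\<lambda>l. (\<phi> v* H) $ l * ?s (\<lambda>d. G $ l $ d * x d))
          = ?s (\<lambda>l. ?s (\<lambda>e. \<phi> $ e * (H $ e $ l * ?s (\<lambda>d. G $ l $ d * x d))))"
          by (simp only:)
        also have "\<dots> = ?s (\<lambda>e. \<phi> $ e * ?s (\<lambda>l. H $ e $ l * ?s (\<lambda>d. G $ l $ d * x d)))"
          by (subst sum.swap) (simp only: sum_distrib_left)
        finally show ?thesis
          by (simp only: sum_matrix_mult(1)[symmetric] HG sum_one_entry)
      qed
      then show ?thesis by simp
    qed
    also have "\<dots> = (transpose H ** contract \<phi> c ** H) $ i $ j"
      unfolding matrix_mul_assoc[symmetric]
      by (simp add: contract_def matrix_matrix_mult_def transpose_def mult.commute)
    finally show ?thesis .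
  qed
  then show ?thesis by (simp add: vec_eq_iff)
qed

lemma regular_on_left_trace: "(\<lambda>c. left_trace c $ i) \<in> regular_on U"
  unfolding left_trace_def by (simp add: regular_on_sum regular_on_var)

lemma regular_on_right_trace: "(\<lambda>c. right_trace c $ i) \<in> regular_on U"
  unfolding right_trace_def by (simp add: regular_on_sum regular_on_var)

lemma regular_on_contract:
  assumes "\<And>l. (\<lambda>c. \<phi> c $ l) \<in> regular_on U"
  shows "(\<lambda>c. contract (\<phi> c) c $ i $ j) \<in> regular_on U"
  unfolding contract_def by (simp add: regular_on_sum regular_on_mult regular_on_var assms)

lemma regular_on_matrix_mult:
  fixes M M' :: "('v \<Rightarrow> 'k::field) \<Rightarrow> 'k ^ 'n ^ 'n::finite"
  assumes "\<And>i j. (\<lambda>c. M c $ i $ j) \<in> regular_on U" "\<And>i j. (\<lambda>c. M' c $ i $ j) \<in> regular_on U"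
  shows "(\<lambda>c. (M c ** M' c) $ i $ j) \<in> regular_on U"
  unfolding matrix_matrix_mult_def by (simp add: regular_on_sum regular_on_mult assms)

lemma regular_on_vector_matrix_mult:
  fixes M :: "('v \<Rightarrow> 'k::field) \<Rightarrow> 'k ^ 'n ^ 'n::finite"
  assumes "\<And>i. (\<lambda>c. x c $ i) \<in> regular_on U" "\<And>i j. (\<lambda>c. M c $ i $ j) \<in> regular_on U"
  shows "(\<lambda>c. (x c v* M c) $ j) \<in> regular_on U"
  unfolding vector_matrix_mult_def by (simp add: regular_on_sum regular_on_mult assms)

section \<open>The operator linking the two trace forms, and its covectors\<close>

definition left_form :: "('n::finite, 'k::field) tensorM \<Rightarrow> 'k ^ 'n ^ 'n" where
  "left_form c = contract (left_trace c) c"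

definition trace_op :: "('n::finite, 'k::field) tensorM \<Rightarrow> 'k ^ 'n ^ 'n" where
  "trace_op c = matrix_inv (left_form c) ** contract (right_trace c) c"

lemma det_nonzero_if_inverse:
  fixes G H :: "'k::field ^ 'n ^ 'n::finite"
  assumes "H ** G = mat 1"
  shows "det H \<noteq> 0"
  using det_mul[of H G] assms by auto

lemma left_form_mat_act:
  assumes "H ** G = mat 1"
  shows "left_form (mat_act G H c) = transpose H ** left_form c ** H"
  unfolding left_form_def left_trace_mat_act[OF assms] contract_mat_act[OF assms] ..

lemma det_left_form_mat_act:
  fixes G H :: "'k::field ^ 'n ^ 'n::finite"
  assumes "H ** G = mat 1"
  shows "det (left_form (mat_act G H c)) = 0 \<longleftrightarrow> det (left_form c) = 0"
  using det_nonzero_if_inverse[OF assms] by (simp add: left_form_mat_act[OF assms] det_mul)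

text \<open>An invertible form can be cancelled on the left, so the defining equation identifies the
  operator. Equivariance and the value on the slice are both verified through it, without computing
  an inverse.\<close>

lemma trace_op_unique:
  assumes "det (left_form c) \<noteq> 0" "left_form c ** T = contract (right_trace c) c"
  shows "trace_op c = T"
proof -
  have "trace_op c = matrix_inv (left_form c) ** left_form c ** T"
    unfolding trace_op_def by (simp add: assms(2) flip: matrix_mul_assoc)
  then show ?thesis by (simp add: matrix_inv_mult assms(1))
qed

lemma left_form_trace_op:
  assumes "det (left_form c) \<noteq> 0"
  shows "left_form c ** trace_op c = contract (right_trace c) c"
  unfolding trace_op_def by (simp add: matrix_mul_assoc matrix_inv_mult[OF assms])

lemma trace_op_mat_act:
  fixes G H :: "'k::field ^ 'n ^ 'n::finite"
  assumes GH: "G ** H = mat 1" and HG: "H ** G = mat 1" and det: "det (left_form c) \<noteq> 0"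
  shows "trace_op (mat_act G H c) = G ** trace_op c ** H"
proof (rule trace_op_unique)
  show "det (left_form (mat_act G H c)) \<noteq> 0"
    using det det_left_form_mat_act[OF HG] by blast
  have "left_form (mat_act G H c) ** (G ** trace_op c ** H)
      = transpose H ** left_form c ** (H ** G) ** trace_op c ** H"
    by (simp add: left_form_mat_act[OF HG] matrix_mul_assoc)
  also have "\<dots> = transpose H ** (left_form c ** trace_op c) ** H"
    by (simp add: HG matrix_mul_assoc)
  also have "\<dots> = contract (right_trace (mat_act G H c)) (mat_act G H c)"
    by (simp add: left_form_trace_op[OF det] right_trace_mat_act[OF HG] contract_mat_act[OF HG])
  finally show "left_form (mat_act G H c) ** (G ** trace_op c ** H)
    = contract (right_trace (mat_act G H c)) (mat_act G H c)" .
qed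

text \<open>The index is shifted: \<open>Suc k\<close> carries \<open>k\<close> applications of
  \<open>trace_op\<close>, and the step from 0 to 1 passes from one trace to the other.\<close>

primrec trace_covector :: "('n::finite, 'k::field) tensorM \<Rightarrow> nat \<Rightarrow> 'k ^ 'n" where
  "trace_covector c 0 = left_trace c"
| "trace_covector c (Suc k) = ((\<lambda>x. x v* trace_op c) ^^ k) (right_trace c)"

lemma trace_covector_mat_act:
  fixes G H :: "'k::field ^ 'n ^ 'n::finite"
  assumes GH: "G ** H = mat 1" and HG: "H ** G = mat 1" and det: "det (left_form c) \<noteq> 0"
  shows "trace_covector (mat_act G H c) k = trace_covector c k v* H"
proof (cases k)
  case 0
  then show ?thesis by (simp add: left_trace_mat_act[OF HG])
next
  case (Suc m)
  have "((\<lambda>x. x v* trace_op (mat_act G H c)) ^^ m) (right_trace (mat_act G H c))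
    = ((\<lambda>x. x v* trace_op c) ^^ m) (right_trace c) v* H"
  proof (induction m)
    case 0
    show ?case by (simp add: right_trace_mat_act[OF HG])
  next
    case (Suc m)
    \<comment> \<open>The trailing \<open>H\<close> of the previous iterate cancels the leading
      \<open>G\<close> of the conjugated operator.\<close>
    have "x v* H v* (G ** trace_op c ** H) = x v* ((H ** G) ** trace_op c ** H)" for x :: "'k ^ 'n"
      by (simp add: vector_matrix_mul_assoc matrix_mul_assoc)
    then show ?case
      using Suc by (simp add: trace_op_mat_act[OF GH HG det] HG flip: vector_matrix_mul_assoc)
  qed
  then show ?thesis using Suc by simp
qed

lemma regular_on_left_form: "(\<lambda>c. left_form c $ i $ j) \<in> regular_on U"
  unfolding left_form_def by (intro regular_on_contract regular_on_left_trace)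

lemma regular_on_trace_op:
  assumes "\<And>c. c \<in> U \<Longrightarrow> det (left_form c) \<noteq> 0"
  shows "(\<lambda>c. trace_op c $ i $ j) \<in> regular_on U"
  unfolding trace_op_def
  by (intro regular_on_matrix_mult regular_on_matrix_inv regular_on_left_form
      regular_on_contract regular_on_right_trace assms)

lemma regular_on_trace_covector:
  assumes "\<And>c. c \<in> U \<Longrightarrow> det (left_form c) \<noteq> 0"
  shows "(\<lambda>c. trace_covector c k $ i) \<in> regular_on U"
proof (cases k)
  case 0
  then show ?thesis by (simp add: regular_on_left_trace)
next
  case (Suc m)
  have "(\<lambda>c. ((\<lambda>x. x v* trace_op c) ^^ m) (right_trace c) $ i) \<in> regular_on U"
  proof (induction m arbitrary: i)
    case 0
    show ?case by (simp add: regular_on_right_trace)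
  next
    case (Suc m)
    show ?case
      by (simp, intro regular_on_vector_matrix_mult Suc regular_on_trace_op assms)
  qed
  then show ?thesis using Suc by simp
qed

section \<open>The slice in dimension at least three\<close>

lemma sum_split_point: "(\<Sum>x\<in>UNIV. g x) = g a + (\<Sum>x\<in>-{a}. g x)" for a :: "'n::finite"
  by (subst sum.remove[of UNIV a]) (auto simp: Compl_eq_Diff_UNIV)

lemma axis_vector_matrix_mult: "axis i 1 v* M = M $ i"
  for M :: "'k::field ^ 'n ^ 'n::finite"
  by (simp add: vec_eq_iff vector_matrix_mult_def axis_def if_distrib if_distribR cong: if_cong)

lemma mat_1_row: "(mat 1 :: 'k::field ^ 'n ^ 'n::finite) $ i = axis i 1"
  by (auto simp: vec_eq_iff mat_def axis_def)

lemma contract_axis: "contract (axis a 1) c = (\<chi> i j. c (i, j, a))"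
  for c :: "('n::finite, 'k::field) tensorM"
proof -
  have "axis a (1::'k) $ l * x = (if l = a then x else 0)" for l x
    by (simp add: axis_def)
  then show ?thesis by (simp add: contract_def vec_eq_iff)
qed

text \<open>The index type carries no order, so \<open>e\<close> numbers the basis, starting from
  0.\<close>

locale enumeration =
  fixes e :: "nat \<Rightarrow> 'n::finite"
  assumes bij: "bij_betw e {..<CARD('n)} UNIV"
    and card3: "3 \<le> CARD('n)"
begin

definition idx :: "'n \<Rightarrow> nat" where
  "idx = the_inv_into {..<CARD('n)} e"

lemma e_idx [simp]: "e (idx i) = i"
  using bij unfolding idx_def bij_betw_def by (simp add: f_the_inv_into_f)

lemma idx_less [simp]: "idx i < CARD('n)"
  using bij the_inv_into_into[of e "{..<CARD('n)}" i "{..<CARD('n)}"] unfolding idx_def bij_betw_def by auto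

lemma idx_e: "k < CARD('n) \<Longrightarrow> idx (e k) = k"
  using bij unfolding idx_def bij_betw_def by (simp add: the_inv_into_f_f)

lemma e_eq_iff: "k < CARD('n) \<Longrightarrow> l < CARD('n) \<Longrightarrow> e k = e l \<longleftrightarrow> k = l"
  using idx_e by metis

text \<open>The first, second, third and last indices. In dimension three \<open>z\<close> and
  \<open>y\<close> coincide.\<close>

definition "o' = e 0"
definition "w = e 1"
definition "z = e 2"
definition "y = e (CARD('n) - 1)"

lemma distinct [simp]: "o' \<noteq> w" "w \<noteq> o'" "o' \<noteq> z" "z \<noteq> o'" "w \<noteq> z" "z \<noteq> w" "y \<noteq> o'" "o' \<noteq> y" "y \<noteq> w" "w \<noteq> y"
  using card3 by (simp_all add: o'_def w_def z_def y_def e_eq_iff)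

lemma sum_split_indices:
  "(\<Sum>x\<in>-{z}. g x) = g o' + (g w + (\<Sum>x\<in>-{o', w, z}. g x))"
proof -
  have "- {z} - {o'} - {w} = - {o', w, z}" by auto
  then show ?thesis
    by (simp add: sum.remove[of "-{z}" o'] sum.remove[of "-{z}-{o'}" w])
qed

definition frame :: "('n, 'k::field) tensorM \<Rightarrow> 'k ^ 'n ^ 'n" where
  "frame c = (\<chi> i. trace_covector c (idx i))"

text \<open>Acting on row vectors, the prescribed rows send every basis covector except the first
  and the last to its successor, as a standard frame demands. The rows \<open>s\<close> and
  \<open>t\<close> remain free.\<close>

definition companion :: "('n \<Rightarrow> 'k::field) \<Rightarrow> ('n \<Rightarrow> 'k) \<Rightarrow> 'k ^ 'n ^ 'n" where
  "companion s t = (\<chi> i j. if i = o' then s j else if i = y then t j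
     else if j = e (Suc (idx i)) then 1 else 0)"

text \<open>Layer \<open>w\<close> is left out because on the slice it is the product of layer
  \<open>o'\<close> with the operator.\<close>

definition params :: "('n \<times> 'n \<times> 'n) set" where
  "params = {(i, j, l). l \<noteq> w}"

text \<open>On the slice the entries at (i,z,z), (z,j,z) and (o',z,o') are determined by the two trace
  conditions, so these slots of the parameter u carry the first and last row of the operator.\<close>
definition op_of :: "('n \<times> 'n \<times> 'n \<Rightarrow> 'k::field) \<Rightarrow> 'k ^ 'n ^ 'n" where
  "op_of u = companion (\<lambda>j. u (j, z, z)) (\<lambda>j. if j = z then u (o', z, o') else u (z, j, z))"

text \<open>Both trace conditions at \<open>z\<close> determine the entry (z,z,z), so the remaining
  terms of the two sums must agree. \<open>corner\<close> is that equation solved for the entry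
  (o',z,o'). There is no circularity: the layer \<open>w\<close> entries involved use only rows
  \<open>z\<close> and \<open>w\<close> of the form, which differ from row
  \<open>o'\<close>.\<close>

definition corner :: "('n \<times> 'n \<times> 'n \<Rightarrow> 'k::field) \<Rightarrow> 'k" where
  "corner u = u (z, o', o') + (\<Sum>m\<in>UNIV. u (z, m, o') * op_of u $ m $ w)
     - (\<Sum>m\<in>UNIV. u (w, m, o') * op_of u $ m $ z) - (\<Sum>i\<in>-{o', w, z}. u (i, z, i) - u (z, i, i))"

definition form_of :: "('n \<times> 'n \<times> 'n \<Rightarrow> 'k::field) \<Rightarrow> 'k ^ 'n ^ 'n" where
  "form_of u = (\<chi> i j. if i = o' \<and> j = z then corner u else u (i, j, o'))"

definition lower :: "('n \<times> 'n \<times> 'n \<Rightarrow> 'k::field) \<Rightarrow> 'n \<Rightarrow> 'n \<Rightarrow> 'n \<Rightarrow> 'k" where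
  "lower u i j l = (if l = o' then form_of u $ i $ j
     else if l = w then (form_of u ** op_of u) $ i $ j else u (i, j, l))"

text \<open>In layer \<open>z\<close> the entry (i,z,z) is solved from the left trace at
  \<open>i\<close> and (z,j,z) from the right trace at \<open>j\<close>. The overlap (z,z,z) is
  solved from the left trace; the choice of \<open>corner\<close> makes it fit the right
  one.\<close>

definition slice :: "('n \<times> 'n \<times> 'n \<Rightarrow> 'k::field) \<Rightarrow> ('n, 'k) tensorM" where
  "slice u = (\<lambda>(i, j, l). if l \<noteq> z then lower u i j l
     else if j = z then (if i = o' then 1 else 0) - (\<Sum>b\<in>-{z}. lower u i b b)
     else if i = z then (if j = w then 1 else 0) - (\<Sum>a\<in>-{z}. lower u a j a)
     else u (i, j, z))"

lemma slice_apply: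
  "slice u (i, j, l) = (if l \<noteq> z then lower u i j l
     else if j = z then (if i = o' then 1 else 0) - (\<Sum>b\<in>-{z}. lower u i b b)
     else if i = z then (if j = w then 1 else 0) - (\<Sum>a\<in>-{z}. lower u a j a)
     else u (i, j, z))"
  by (simp add: slice_def)

text \<open>Inverse of \<open>slice\<close>. The first row of the operator fills the slots (i,z,z),
  including (z,z,z), so the entry of the last row in column \<open>z\<close> moves to (o',z,o'), the
  slot freed by \<open>corner\<close>.\<close>

definition coord :: "'n \<times> 'n \<times> 'n \<Rightarrow> ('n, 'k::field) tensorM \<Rightarrow> 'k" where
  "coord = (\<lambda>(i, j, l) c. if l = z \<and> j = z then trace_op c $ o' $ i
     else if l = z \<and> i = z then trace_op c $ y $ j
     else if (i, j, l) = (o', z, o') then trace_op c $ y $ z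
     else c (i, j, l))"

section \<open>Polynomiality of the parametrisation\<close>

lemma polyfun_op_of: "(\<lambda>u. op_of u $ i $ j) \<in> polyfun params"
  unfolding op_of_def companion_def
  by (simp only: vec_lambda_beta, intro polyfun_if polyfun.const polyfun.var) (auto simp: params_def)

lemma polyfun_corner: "corner \<in> polyfun params"
proof -
  have "(\<lambda>u. corner u) \<in> polyfun params"
    unfolding corner_def
    by (intro polyfun_sum polyfun_op_of polyfun.add polyfun_diff polyfun.mult polyfun.var)
      (auto simp: params_def)
  then show ?thesis by simp
qed

lemma polyfun_form_of: "(\<lambda>u. form_of u $ i $ j) \<in> polyfun params"
  unfolding form_of_def
  by (simp only: vec_lambda_beta, intro polyfun_if polyfun_corner polyfun.var) (auto simp: params_def)

lemma polyfun_lower: "(\<lambda>u. lower u i j l) \<in> polyfun params"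
  unfolding lower_def matrix_matrix_mult_def
  by (simp only: vec_lambda_beta, intro polyfun_if polyfun_form_of polyfun_op_of polyfun_sum polyfun.mult polyfun.var)
    (auto simp: params_def)

lemma polyfun_slice: "(\<lambda>u. slice u m) \<in> polyfun params"
  by (cases m, simp only: slice_apply,
      intro polyfun_if polyfun_lower polyfun_sum polyfun_diff polyfun.const polyfun.var)
    (auto simp: params_def)

text \<open>The equation that \<open>corner\<close> was chosen to solve: the right and left traces
  at \<open>z\<close> agree once their common entry (z,z,z) is removed.\<close>

lemma lower_balance: "(\<Sum>a\<in>-{z}. lower u a z a) = (\<Sum>b\<in>-{z}. lower u z b b)"
proof -
  have "(form_of u ** op_of u) $ i $ j = (\<Sum>m\<in>UNIV. u (i, m, o') * op_of u $ m $ j)" if "i \<noteq> o'" for i j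
    using that by (simp add: matrix_matrix_mult_def form_of_def)
  moreover have "(\<Sum>x\<in>-{o', w, z}. lower u x z x) = (\<Sum>x\<in>-{o', w, z}. u (x, z, x))"
    "(\<Sum>x\<in>-{o', w, z}. lower u z x x) = (\<Sum>x\<in>-{o', w, z}. u (z, x, x))"
    by (auto intro!: sum.cong simp: lower_def)
  ultimately show ?thesis
    unfolding sum_split_indices by (simp add: lower_def form_of_def corner_def sum_subtractf)
qed

lemma left_trace_slice: "left_trace (slice u) = axis o' 1"
proof -
  have "(\<Sum>j\<in>UNIV. slice u (i, j, j)) = (if i = o' then 1 else 0)" for i
    unfolding sum_split_point[of _ z] by (simp add: slice_apply)
  then show ?thesis by (simp add: vec_eq_iff left_trace_def axis_def)
qed

text \<open>Only \<open>j = z\<close> needs more than the definition: there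
  \<open>lower_balance\<close> reduces the claim to the left trace, both prescribed values being
  0.\<close>

lemma right_trace_slice: "right_trace (slice u) = axis w 1"
proof -
  have "(\<Sum>i\<in>UNIV. slice u (i, j, i)) = (if j = w then 1 else 0)" for j
    unfolding sum_split_point[of _ z] by (simp add: slice_apply lower_balance)
  then show ?thesis by (simp add: vec_eq_iff right_trace_def axis_def)
qed

lemma left_form_slice: "left_form (slice u) = form_of u"
  by (simp add: left_form_def left_trace_slice contract_axis vec_eq_iff slice_apply lower_def)

text \<open>Layer \<open>w\<close> of the slice was defined as the product that
  \<open>trace_op_unique\<close> asks for.\<close>

lemma trace_op_slice: "det (form_of u) \<noteq> 0 \<Longrightarrow> trace_op (slice u) = op_of u"
  by (rule trace_op_unique)
    (simp_all add: left_form_slice right_trace_slice contract_axis vec_eq_iff slice_apply lower_def)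

lemma op_of_row:
  assumes "0 < k" "Suc k < CARD('n)"
  shows "op_of u $ e k = axis (e (Suc k)) 1"
proof -
  have "e k \<noteq> o'" "e k \<noteq> y" "idx (e k) = k"
    using assms by (simp_all add: o'_def y_def e_eq_iff idx_e)
  then show ?thesis by (simp add: op_of_def companion_def vec_eq_iff axis_def)
qed

text \<open>The two traces are the first two basis covectors, and the companion rows then carry the
  second one through all the others.\<close>

lemma frame_slice:
  assumes "det (form_of u) \<noteq> 0"
  shows "frame (slice u) = mat 1"
proof -
  have "((\<lambda>x. x v* op_of u) ^^ k) (axis w 1) = axis (e (Suc k)) 1" if "Suc k < CARD('n)" for k
    using that by (induction k) (simp_all add: w_def axis_vector_matrix_mult op_of_row)
  then have "trace_covector (slice u) k = axis (e k) 1" if "k < CARD('n)" for k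
    using that by (cases k) (simp_all add: left_trace_slice right_trace_slice trace_op_slice[OF assms] flip: o'_def)
  then show ?thesis
    by (simp add: frame_def vec_eq_iff[of _ "mat 1"] mat_1_row)
qed

lemma coord_slice:
  assumes "det (form_of u) \<noteq> 0" "v \<in> params"
  shows "coord v (slice u) = u v"
  using assms(2)
  by (auto simp: params_def coord_def trace_op_slice[OF assms(1)] op_of_def companion_def
    slice_apply lower_def form_of_def)

text \<open>An identity frame fixes both traces and all inner rows of the operator. The defining
  equation of the operator then returns layer \<open>w\<close>, and the trace conditions return the
  remaining solved entries.\<close>

lemma slice_coord:
  fixes c :: "('n, 'k::field) tensorM"
  assumes det: "det (left_form c) \<noteq> 0" and frame: "frame c = mat 1"
  shows "slice (\<lambda>v. coord v c) = c"
proof -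
  define u where "u = (\<lambda>v. coord v c)"
  have cov: "trace_covector c k = axis (e k) 1" if "k < CARD('n)" for k
  proof -
    have "frame c $ e k = axis (e k) 1" by (simp add: frame mat_1_row)
    then show ?thesis by (simp add: frame_def idx_e that)
  qed
  have "0 < CARD('n)" "Suc 0 < CARD('n)" using card3 by linarith+
  note cov[OF this(1)] cov[OF this(2)]
  then have left: "left_trace c = axis o' 1" and right: "right_trace c = axis w 1"
    by (simp_all only: o'_def w_def trace_covector.simps funpow_0 One_nat_def)
  have "trace_op c $ i = op_of u $ i" for i
  proof (cases "i = o' \<or> i = y")
    case True
    have "op_of u $ o' $ j = trace_op c $ o' $ j" "op_of u $ y $ j = trace_op c $ y $ j" for j
      by (simp_all add: op_of_def companion_def u_def coord_def)
    then show ?thesis using True by (metis vec_eq_iff)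
  next
    case False
    define k where "k = idx i"
    have i: "i = e k" by (simp add: k_def)
    have "k < CARD('n)" by (simp add: k_def)
    moreover have "k \<noteq> 0" "k \<noteq> CARD('n) - 1"
      using False i unfolding o'_def y_def by metis+
    ultimately have k: "0 < k" "Suc k < CARD('n)" by auto
    \<comment> \<open>The recursion by \<open>trace_op\<close> starts only at index 1, so
      \<open>k\<close> has to be a successor.\<close>
    then obtain m where m: "k = Suc m" using gr0_implies_Suc by blast
    have "trace_covector c (Suc k) = trace_covector c k v* trace_op c"
      by (simp add: m)
    then have "axis (e (Suc k)) 1 = axis (e k) 1 v* trace_op c"
      unfolding cov[OF k(2)] cov[OF Suc_lessD[OF k(2)]] .
    then have "trace_op c $ i = axis (e (Suc k)) 1"
      by (simp add: i axis_vector_matrix_mult)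
    then show ?thesis using op_of_row[OF k, of u] i by simp
  qed
  then have op: "op_of u = trace_op c" by (simp add: vec_eq_iff)
  have form: "left_form c = (\<chi> i j. c (i, j, o'))"
    by (simp add: left_form_def left contract_axis)
  have cw: "(\<Sum>m\<in>UNIV. c (i, m, o') * trace_op c $ m $ j) = c (i, j, w)" for i j
    using left_form_trace_op[OF det]
    by (simp add: form right contract_axis vec_eq_iff matrix_matrix_mult_def)
  have tr: "(\<Sum>b\<in>-{z}. c (i, b, b)) = (if i = o' then 1 else 0) - c (i, z, z)"
    "(\<Sum>a\<in>-{z}. c (a, j, a)) = (if j = w then 1 else 0) - c (z, j, z)" for i j
  proof -
    have "left_trace c $ i = axis o' 1 $ i" "right_trace c $ j = axis w 1 $ j"
      by (simp_all only: left right)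
    then show "(\<Sum>b\<in>-{z}. c (i, b, b)) = (if i = o' then 1 else 0) - c (i, z, z)"
      "(\<Sum>a\<in>-{z}. c (a, j, a)) = (if j = w then 1 else 0) - c (z, j, z)"
      by (auto simp: left_trace_def right_trace_def axis_def sum_split_point[of _ z] algebra_simps split: if_splits)
  qed
  have u: "u (i, j, l) = c (i, j, l)" if "l \<noteq> z \<or> (i \<noteq> z \<and> j \<noteq> z)" "(i, j, l) \<noteq> (o', z, o')" for i j l
    using that by (auto simp: u_def coord_def)
  have "corner u = c (o', z, o')"
  proof -
    have "(\<Sum>i\<in>-{o', w, z}. u (i, z, i) - u (z, i, i)) = (\<Sum>i\<in>-{o', w, z}. c (i, z, i) - c (z, i, i))"
      by (auto intro!: sum.cong simp: u)
    then have "corner u = c (z, o', o') + c (z, w, w) - c (w, z, w)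
        - (\<Sum>i\<in>-{o', w, z}. c (i, z, i) - c (z, i, i))"
      by (simp add: corner_def op u cw)
    \<comment> \<open>Both sums equal \<open>- c (z, z, z)\<close>; this is the equation behind
      \<open>corner\<close>.\<close>
    moreover have "(\<Sum>a\<in>-{z}. c (a, z, a)) = (\<Sum>b\<in>-{z}. c (z, b, b))"
      by (simp add: tr)
    ultimately have "corner u + (c (w, z, w) + (\<Sum>i\<in>-{o', w, z}. c (i, z, i)))
        = c (o', z, o') + (c (w, z, w) + (\<Sum>i\<in>-{o', w, z}. c (i, z, i)))"
      unfolding sum_split_indices by (simp add: sum_subtractf algebra_simps)
    then show ?thesis by (simp only: add_right_cancel)
  qed
  then have "form_of u $ i $ j = c (i, j, o')" for i j
    by (simp add: form_of_def u)
  then have lower: "lower u i j l = c (i, j, l)" if "l \<noteq> z" for i j l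
    using that by (simp add: lower_def matrix_matrix_mult_def op cw u)
  have "(\<Sum>b\<in>-{z}. lower u i b b) = (\<Sum>b\<in>-{z}. c (i, b, b))"
    "(\<Sum>a\<in>-{z}. lower u a j a) = (\<Sum>a\<in>-{z}. c (a, j, a))" for i j
    by (auto intro!: sum.cong simp: lower)
  then have "slice u (i, j, l) = c (i, j, l)" for i j l
    by (simp add: slice_apply lower tr u)
  then show ?thesis unfolding u_def by auto
qed

text \<open>For this \<open>u\<close> the form is the identity plus the single entry
  \<open>corner u\<close> off the diagonal. Whatever that value is, reversing its sign gives the
  inverse \<open>R\<close>.\<close>

lemma exists_nondegenerate: "\<exists>u :: 'n \<times> 'n \<times> 'n \<Rightarrow> 'k::field. det (form_of u) \<noteq> 0"
proof
  define u :: "'n \<times> 'n \<times> 'n \<Rightarrow> 'k" where "u = (\<lambda>(i, j, l). if i = j then 1 else 0)"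
  define R :: "'k ^ 'n ^ 'n" where "R = (\<chi> i j. if i = j then 1 else if i = o' \<and> j = z then - corner u else 0)"
  have "(form_of u ** R) $ i $ j = (mat 1 :: 'k ^ 'n ^ 'n) $ i $ j" for i j
  proof -
    have "form_of u $ i $ m * x = (if m = i then x else 0) + (if i = o' \<and> m = z then corner u * x else 0)" for m x
      by (auto simp: form_of_def u_def)
    then have "(form_of u ** R) $ i $ j = R $ i $ j + (if i = o' then corner u * R $ z $ j else 0)"
      by (auto simp: matrix_matrix_mult_def sum.distrib)
    then show ?thesis by (auto simp: R_def mat_def)
  qed
  then have "form_of u ** R = mat 1" by (simp add: vec_eq_iff)
  then show "det (form_of u) \<noteq> 0"
    by (rule det_nonzero_if_inverse)
qed

end

section \<open>Parameter count and the result in dimension at least three\<close>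

lemma (in enumeration) card_params: "card (params :: ('n \<times> 'n \<times> 'n) set) = CARD('n) ^ 3 - CARD('n) ^ 2"
proof -
  have "params = UNIV \<times> UNIV \<times> (- {w})" by (auto simp: params_def)
  then have "card (params :: ('n \<times> 'n \<times> 'n) set) = CARD('n) * (CARD('n) * (CARD('n) - 1))"
    by (simp add: card_cartesian_product Compl_eq_Diff_UNIV)
  then show ?thesis by (simp add: algebra_simps power2_eq_square power3_eq_cube)
qed

lemma (in enumeration) invariant_field_rational:
  assumes inf: "infinite (UNIV :: 'k::field set)"
  shows "invariant_field_rational_trdeg TYPE('n) TYPE('k) (CARD('n) ^ 3 - CARD('n) ^ 2)"
proof -
  define U where "U = {c :: ('n, 'k) tensorM. det (left_form c) \<noteq> 0 \<and> det (frame c) \<noteq> 0}"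
  \<comment> \<open>The domain is cut out in two stages, since regularity of the frame is
    established only where \<open>left_form\<close> is invertible.\<close>
  obtain D1 :: "('n, 'k) tensorM \<Rightarrow> 'k"
    where D1: "D1 \<in> polyfun UNIV" "{c. D1 c \<noteq> 0} = {c. det (left_form c) \<noteq> 0}"
    by (rule regular_on_UNIV_nonvanishing[OF regular_on_det[OF regular_on_left_form]])
  have reg: "(\<lambda>c. frame c $ i $ j) \<in> regular_on W"
    if "\<And>c. c \<in> W \<Longrightarrow> det (left_form c) \<noteq> 0" for i j and W :: "('n, 'k) tensorM set"
    using that by (simp add: frame_def regular_on_trace_covector)
  have "(\<lambda>c. det (frame c)) \<in> regular_on {c. D1 c \<noteq> 0}"
    by (intro regular_on_det reg) (use D1(2) in auto)
  then obtain D where D: "D \<in> polyfun UNIV" "{c. D c \<noteq> 0} = {c. D1 c \<noteq> 0 \<and> det (frame c) \<noteq> 0}"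
    by (rule regular_on_nonvanishing[OF D1(1)])
  have U: "U = {c. D c \<noteq> 0}"
    using D(2) D1(2) unfolding U_def by blast
  have equiv: "frame (mat_act G H c) = frame c ** H"
    if "G ** H = mat 1" "H ** G = mat 1" "c \<in> U" for G H and c :: "('n, 'k) tensorM"
    using that trace_covector_mat_act[OF that(1,2), of c]
    by (simp add: U_def frame_def vec_eq_iff matrix_matrix_mult_def vector_matrix_mult_def)
  have slice_U: "slice u \<in> U \<longleftrightarrow> det (form_of u) \<noteq> 0" for u :: "'n \<times> 'n \<times> 'n \<Rightarrow> 'k"
    using frame_slice[of u] by (auto simp: U_def left_form_slice)
  show ?thesis
    unfolding card_params[symmetric]
  proof (rule invariant_field_rational_of_frame[OF inf D(1) U, where F = frame and f = coord and \<Psi> = slice])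
    show "U \<noteq> {}"
      using exists_nondegenerate slice_U by blast
    show "mat_act G H c \<in> U" if "G ** H = mat 1" "H ** G = mat 1" "c \<in> U" for G H c
      using that equiv[OF that] det_left_form_mat_act[OF that(2), of c] det_nonzero_if_inverse[OF that(2)]
      by (simp add: U_def det_mul)
    show "frame (mat_act G H c) = frame c ** H" if "G ** H = mat 1" "H ** G = mat 1" "c \<in> U" for G H c
      using equiv that .
    show "det (frame c) \<noteq> 0" if "c \<in> U" for c
      using that by (simp add: U_def)
    show "(\<lambda>c. frame c $ i $ j) \<in> regular_on U" for i j
      by (rule reg) (simp add: U_def)
    show "finite params" by simp
    show "coord v \<in> regular_on U" for v
    proof -
      have "(\<lambda>c. trace_op c $ i $ j) \<in> regular_on U" for i j
        by (rule regular_on_trace_op) (simp add: U_def)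
      then show ?thesis
        by (cases v) (simp only: coord_def prod.case, intro regular_on_if regular_on_var)
    qed
    show "(\<lambda>u. slice u m) \<in> polyfun params" for m
      by (rule polyfun_slice)
    show "slice (\<lambda>v. coord v c) = c" if "c \<in> U" "frame c = mat 1" for c
      using that slice_coord by (simp add: U_def)
    show "frame (slice u) = mat 1" if "slice u \<in> U" for u
      using that slice_U frame_slice by blast
    show "coord v (slice u) = u v" if "slice u \<in> U" "v \<in> params" for u v
      using that slice_U coord_slice by blast
  qed
qed

section \<open>Dimensions one and two\<close>

text \<open>In dimension at most two the covectors of the two traces already form a frame.\<close>
definition trace_frame :: "'n::finite \<Rightarrow> ('n, 'k::field) tensorM \<Rightarrow> 'k ^ 'n ^ 'n" where
  "trace_frame a c = (\<chi> i. if i = a then left_trace c else right_trace c)"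

text \<open>This frame is polynomial and equivariant everywhere, so its determinant alone defines
  the domain, which contains every point of the slice.\<close>

lemma invariant_field_rational_of_trace_frame:
  fixes f :: "'v \<Rightarrow> ('n::finite, 'k::field) tensorM \<Rightarrow> 'k"
  assumes inf: "infinite (UNIV :: 'k set)"
    and fin: "finite K"
    and f: "\<And>v. v \<in> K \<Longrightarrow> f v \<in> polyfun UNIV"
    and \<Psi>: "\<And>m. (\<lambda>u. \<Psi> u m) \<in> polyfun K"
    and chart: "\<And>c. trace_frame a c = mat 1 \<Longrightarrow> \<Psi> (\<lambda>v. f v c) = c"
    and slice: "\<And>u. trace_frame a (\<Psi> u) = mat 1"
    and coord: "\<And>u v. v \<in> K \<Longrightarrow> f v (\<Psi> u) = u v"
  shows "invariant_field_rational_trdeg TYPE('n) TYPE('k) (card K)"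
proof -
  define U where "U = {c :: ('n, 'k) tensorM. det (trace_frame a c) \<noteq> 0}"
  have reg: "(\<lambda>c :: ('n, 'k) tensorM. trace_frame a c $ i $ j) \<in> regular_on W" for i j W
    by (cases "i = a") (simp_all add: trace_frame_def regular_on_left_trace regular_on_right_trace)
  obtain D :: "('n, 'k) tensorM \<Rightarrow> 'k"
    where D: "D \<in> polyfun UNIV" "{c. D c \<noteq> 0} = {c. det (trace_frame a c) \<noteq> 0}"
    by (rule regular_on_UNIV_nonvanishing[OF regular_on_det[OF reg]])
  have U: "U = {c. D c \<noteq> 0}" using D(2) by (simp add: U_def)
  have equiv: "trace_frame a (mat_act G H c) = trace_frame a c ** H"
    if "H ** G = mat 1" for G H and c :: "('n, 'k) tensorM"
    using left_trace_mat_act[OF that, of c] right_trace_mat_act[OF that, of c]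
    by (simp add: trace_frame_def vec_eq_iff matrix_matrix_mult_def vector_matrix_mult_def)
  show ?thesis
  proof (rule invariant_field_rational_of_frame[OF inf D(1) U, where F = "trace_frame a" and f = f and \<Psi> = \<Psi>])
    have "\<Psi> u \<in> U" for u by (simp add: U_def slice)
    then show "U \<noteq> {}" by blast
    show "mat_act G H c \<in> U" if "H ** G = mat 1" "c \<in> U" for G H c
      using that equiv[OF that(1)] det_nonzero_if_inverse[OF that(1)] by (simp add: U_def det_mul)
  qed (use assms equiv reg in \<open>auto simp: U_def intro: regular_on_polyfun\<close>)
qed

text \<open>The slice is given by four linear equations, each containing exactly one of the four
  entries with \<open>i \<noteq> j\<close>. Solving for these leaves the entries with
  \<open>i = j\<close> as free coordinates.\<close>

lemma invariant_field_rational_dim_2: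
  assumes inf: "infinite (UNIV :: 'k::field set)" and card: "CARD('n::finite) = 2"
  shows "invariant_field_rational_trdeg TYPE('n) TYPE('k) (CARD('n) ^ 3 - CARD('n) ^ 2)"
proof -
  obtain a b :: 'n where ab: "UNIV = {a, b}" "a \<noteq> b"
    using card by (auto simp: card_2_iff)
  have cases: "i = a \<or> i = b" for i using ab(1) by auto
  have sum: "(\<Sum>i\<in>UNIV. g i) = g a + g b" for g :: "'n \<Rightarrow> 'k"
    unfolding ab(1) using ab(2) by simp
  define K where "K = {(i :: 'n, j, l :: 'n). i = j}"
  have "K = (\<lambda>(i, l). (i, i, l)) ` UNIV" by (auto simp: K_def)
  then have "card K = card (UNIV :: ('n \<times> 'n) set)"
    by (simp only:) (rule card_image, auto simp: inj_on_def)
  then have cardK: "card K = CARD('n) ^ 3 - CARD('n) ^ 2"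
    by (simp add: card card_cartesian_product flip: UNIV_Times_UNIV)
  \<comment> \<open>For \<open>i \<noteq> j\<close> the case \<open>l = j\<close> solves the left
    trace at \<open>i\<close>; otherwise \<open>l = i\<close>, and the right trace at
    \<open>j\<close> is solved.\<close>
  define \<Psi> :: "('n \<times> 'n \<times> 'n \<Rightarrow> 'k) \<Rightarrow> ('n, 'k) tensorM" where
    "\<Psi> u = (\<lambda>(i, j, l). if i = j then u (i, j, l)
      else if l = j then (if i = a then 1 else 0) - u (i, i, i)
      else (if j = b then 1 else 0) - u (j, j, j))" for u
  have \<Psi>: "\<Psi> u (i, j, l) = (if i = j then u (i, j, l)
      else if l = j then (if i = a then 1 else 0) - u (i, i, i)
      else (if j = b then 1 else 0) - u (j, j, j))" for u i j l
    by (simp add: \<Psi>_def)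
  have frame_iff: "trace_frame a c = mat 1 \<longleftrightarrow>
      c (a, a, a) + c (a, b, b) = 1 \<and> c (b, a, a) + c (b, b, b) = 0 \<and>
      c (a, a, a) + c (b, a, b) = 0 \<and> c (a, b, a) + c (b, b, b) = 1" for c :: "('n, 'k) tensorM"
  proof -
    have all: "(\<forall>i. P i) \<longleftrightarrow> P a \<and> P b" for P using cases by metis
    show ?thesis
      using ab(2) by (auto simp: vec_eq_iff all trace_frame_def left_trace_def right_trace_def mat_def sum)
  qed
  show ?thesis
    unfolding cardK[symmetric]
  proof (rule invariant_field_rational_of_trace_frame[OF inf, where a = a and f = "\<lambda>v c. c v" and \<Psi> = \<Psi>])
    show "(\<lambda>u. \<Psi> u m) \<in> polyfun K" for m
      by (cases m, simp only: \<Psi>, intro polyfun_if polyfun_diff polyfun.const polyfun.var)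
        (auto simp: K_def)
    show "\<Psi> (\<lambda>v. c v) = c" if "trace_frame a c = mat 1" for c
    proof -
      have "\<Psi> c (i, j, l) = c (i, j, l)" for i j l
        using that[unfolded frame_iff] cases[of i] cases[of j] cases[of l] ab(2)
        by (auto simp: \<Psi> algebra_simps eq_neg_iff_add_eq_0)
      then show ?thesis by auto
    qed
    show "trace_frame a (\<Psi> u) = mat 1" for u
      using ab(2) by (auto simp: frame_iff \<Psi>)
    show "\<Psi> u v = u v" if "v \<in> K" for u v
      using that by (auto simp: K_def \<Psi>)
  qed (auto simp: K_def intro: polyfun.var)
qed

text \<open>The frame is the only structure constant, so the slice is a single point and the
  coordinate set is empty.\<close>

lemma invariant_field_rational_dim_1:
  assumes inf: "infinite (UNIV :: 'k::field set)" and card: "CARD('n::finite) = 1"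
  shows "invariant_field_rational_trdeg TYPE('n) TYPE('k) (CARD('n) ^ 3 - CARD('n) ^ 2)"
proof -
  obtain a :: 'n where a: "UNIV = {a}"
    using card by (auto simp: card_1_singleton_iff)
  then have eq: "i = a" for i by auto
  have frame: "trace_frame a c $ i $ j = c (a, a, a)" for c :: "('n, 'k) tensorM" and i j
    using eq[of i] eq[of j] by (simp add: trace_frame_def left_trace_def a)
  have "invariant_field_rational_trdeg TYPE('n) TYPE('k) (card ({} :: unit set))"
  proof (rule invariant_field_rational_of_trace_frame[OF inf, where a = a and \<Psi> = "\<lambda>_ _. 1"])
    show "(\<lambda>_. 1) = c" if "trace_frame a c = mat 1" for c :: "('n, 'k) tensorM"
    proof -
      have "c (a, a, a) = 1"
        unfolding frame[symmetric, of c a a] that by (simp add: mat_def)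
      then have "c (i, j, l) = 1" for i j l
        using eq[of i] eq[of j] eq[of l] by simp
      then show ?thesis by auto
    qed
    show "trace_frame a (\<lambda>_. 1 :: 'k) = mat 1"
      using eq by (simp add: vec_eq_iff frame mat_def) metis
  qed (auto intro: polyfun.const)
  then show ?thesis by (simp add: card)
qed

theorem theorem1:
  assumes "alg_closed TYPE('k::field)"
    and "(2::'k) \<noteq> 0"
  shows "invariant_field_rational_trdeg TYPE('n::finite) TYPE('k)
           (card (UNIV :: 'n set) ^ 3 - card (UNIV :: 'n set) ^ 2)"
proof -
  have inf: "infinite (UNIV :: 'k set)"
    using assms(1) by (rule infinite_UNIV_if_alg_closed)
  consider "CARD('n) = 1" | "CARD('n) = 2" | "3 \<le> CARD('n)"
    using zero_less_card_finite[where 'a = 'n] by linarith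
  then show ?thesis
  proof cases
    case 1
    with inf show ?thesis by (rule invariant_field_rational_dim_1)
  next
    case 2
    with inf show ?thesis by (rule invariant_field_rational_dim_2)
  next
    case 3
    obtain e :: "nat \<Rightarrow> 'n" where "bij_betw e {..<CARD('n)} UNIV"
      using ex_bij_betw_nat_finite[of "UNIV :: 'n set"] by (auto simp: atLeast0LessThan)
    with 3 interpret enumeration e by unfold_locales
    show ?thesis using inf by (rule invariant_field_rational)
  qed
qed

end
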